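(* Let $(g,\mu,J)$ be a driven cofactor system in adapted coordinates $(y^i,x^a)$, with $J$ and $J_1$ nonsingular. Let $\hat\Gamma$ be the vector field on $T^*M$ representing its equations of motion. Then the $n+1$ quadratic functions $$H_{(i)}=\tfrac12A_{(i)}^{\alpha\beta}p_\alpha p_\beta+W_{(i)},\qquad i=1,\dots,n+1,$$ are first integrals of $\hat\Gamma$, and they are pairwise in involution with respect to both brackets: $$\{H_{(i)},H_{(l)}\}_J=0,\qquad\{H_{(i)},H_{(l)}\}_{P_2}=0,\qquad 1\le i,l\le n+1.$$
   Context: Everything is smooth and the summation convention is used; coordinate domains are taken such that closed 1-forms are exact. Type $(1,1)$ tensors act on 1-forms by their adjoint. Special conformal Killing tensor (scKt) for a Riemannian metric $g$: a type $(1,1)$ tensor field $J$, symmetric with respect to $g$, with $J_{\alpha\beta|\gamma}=\frac12(\alpha_\alpha g_{\beta\gamma}+\alpha_\beta g_{\alpha\gamma})$, where $J_{\alpha\beta}=g_{\alpha\gamma}J^\gamma_\beta$, the bar is the Levi-Civita covariant derivative of $g$, and (necessarily) $\alpha=d(\operatorname{tr}J)$. The cofactor tensor $\operatorname{cof}J$ is defined by $J(\operatorname{cof}J)=(\operatorname{cof}J)J=(\det J)I$ (in general: the adjugate). $d_J$ is the degree 1 derivation of forms anticommuting with $d$ with $d_Jf=J(df)$, and $D_J\rho=d_J\rho+d(\operatorname{tr}J)\wedge\rho$. A cofactor system $(g,\mu,J)$ on $M$ consists of a Riemannian metric $g$, a 1-form $\mu$ and a nonsingular scKt $J$ for $g$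 with $D_J\mu=0$; it represents the equations $\frac{d}{dt}(\partial T/\partial\dot q^\alpha)-\partial T/\partial q^\alpha=Q_\alpha$, with $T=\frac12g_{\alpha\beta}\dot q^\alpha\dot q^\beta$, $\mu=Q_\alpha dq^\alpha$. In terms of $p_\alpha=g_{\alpha\beta}\dot q^\beta$ these are the equations of the vector field $\hat\Gamma=g^{\alpha\beta}p_\beta\frac{\partial}{\partial q^\alpha}+\bigl(\Gamma^\gamma_{\mu\alpha}g^{\mu\delta}p_\gamma p_\delta+Q_\alpha\bigr)\frac{\partial}{\partial p_\alpha}$ on $T^*M$, with $\Gamma^\gamma_{\mu\alpha}$ the Christoffel symbols of $g$. Driven cofactor system in adapted coordinates: a cofactor system on a manifold $M$ of dimension $N=m+n$ with coordinates $q=(y^i,x^a)$, $i=1,\dots,m$, $a=1,\dots,n$, such that $g=g_{ij}(y)dy^i\otimes dy^j+g_{ab}(x)dx^a\otimes dx^b$ (no mixed terms) and $\mu=\mu_1+\mu_2$ with $\mu_1=Q_i(y)dy^i$, $\mu_2=Q_a(x,y)dx^a$, $Q_a=-\partial V/\partial x^a$ for a function $V(x,y)$, and the $\partial Q_a/\partial y^i$ are not all zero. $P_1,P_2$ are the complementary projectors onto $K^\perp=\mathrm{span}\{\partial/\partial y^i\}$ and $K=\mathrm{span}\{\partial/\partial x^a\}$; $J_1=P_1JP_1$ has components $J^i_j$ and its nonsingularity refers to its restriction to $K^\perp$. Let $A(a)=\operatorname{cof}(J+aP_2)=\sum_{i=1}^{n+1}A_{(i)}a^{i-1}$. $P_2$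 formally satisfies the scKt conditions for $g$ and $D_{P_2}\mu=0$, so each $A_{(i)}\mu$ is closed; $W_{(i)}$ is defined (up to a constant) by $A_{(i)}\mu=-dW_{(i)}$, and $A_{(i)}^{\alpha\beta}$ is $A_{(i)}$ with an index raised by $g$. The Poisson tensor of a type $(1,1)$ tensor $J$ with vanishing Nijenhuis torsion is $P_J=J^\alpha_\beta\frac{\partial}{\partial p_\beta}\wedge\frac{\partial}{\partial q^\alpha}-\frac12p_\gamma\Bigl(\frac{\partial J^\gamma_\alpha}{\partial q^\beta}-\frac{\partial J^\gamma_\beta}{\partial q^\alpha}\Bigr)\frac{\partial}{\partial p_\alpha}\wedge\frac{\partial}{\partial p_\beta}$, and the bracket is defined by $P_J(df)=\{f,\cdot\}_J$. For $J=P_2$ this gives $P_{P_2}=\frac{\partial}{\partial p_a}\wedge\frac{\partial}{\partial x^a}$ and the bracket $\{\cdot,\cdot\}_{P_2}$. *)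

theory Defs
  imports "HOL-Analysis.Analysis" "HOL-Computational_Algebra.Polynomial"
begin

section \<open>Calculus on a coordinate domain\<close>

text \<open>
  Everything lives on one coordinate domain \<open>U\<close>, an open subset of \<open>real ^ 'k\<close>; its cotangent
  bundle is \<open>U \<times> real ^ 'k\<close>, with points \<open>(q, p)\<close>. A 1-form is given by its components
  \<open>\<rho> q $ \<alpha>\<close>, a 2-form by the antisymmetric array \<open>\<omega> q $ \<alpha> $ \<beta>\<close> of its values on the coordinate
  fields, and for a type (1,1) tensor the entry \<open>J q $ \<alpha> $ \<beta>\<close> is $J^\alpha_\beta$.
  Thus \<open>J q *v X\<close> is the action on vectors and \<open>\<rho> q v* J q\<close> the adjoint action on 1-forms.
\<close>

definition pd :: "'k::finite \<Rightarrow> (real ^ 'k \<Rightarrow> real) \<Rightarrow> real ^ 'k \<Rightarrow> real" where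
  "pd \<alpha> f q = frechet_derivative f (at q) (axis \<alpha> 1)"

primrec Ck_fn :: "nat \<Rightarrow> (real ^ 'k::finite) set \<Rightarrow> (real ^ 'k \<Rightarrow> real) \<Rightarrow> bool" where
  "Ck_fn 0 U f \<longleftrightarrow> continuous_on U f"
| "Ck_fn (Suc r) U f \<longleftrightarrow> (\<forall>q\<in>U. f differentiable (at q)) \<and> (\<forall>\<alpha>. Ck_fn r U (pd \<alpha> f))"

definition smooth_fn :: "(real ^ 'k::finite) set \<Rightarrow> (real ^ 'k \<Rightarrow> real) \<Rightarrow> bool" where
  "smooth_fn U f \<longleftrightarrow> (\<forall>r. Ck_fn r U f)"

definition smooth_form :: "(real ^ 'k::finite) set \<Rightarrow> (real ^ 'k \<Rightarrow> real ^ 'k) \<Rightarrow> bool" where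
  "smooth_form U \<rho> \<longleftrightarrow> (\<forall>\<alpha>. smooth_fn U (\<lambda>q. \<rho> q $ \<alpha>))"

definition smooth_tensor :: "(real ^ 'k::finite) set \<Rightarrow> (real ^ 'k \<Rightarrow> real ^ 'k ^ 'k) \<Rightarrow> bool" where
  "smooth_tensor U S \<longleftrightarrow> (\<forall>\<alpha> \<beta>. smooth_fn U (\<lambda>q. S q $ \<alpha> $ \<beta>))"

definition d0 :: "(real ^ 'k::finite \<Rightarrow> real) \<Rightarrow> real ^ 'k \<Rightarrow> real ^ 'k" where
  "d0 f q = (\<chi> \<alpha>. pd \<alpha> f q)"

definition d1 :: "(real ^ 'k::finite \<Rightarrow> real ^ 'k) \<Rightarrow> real ^ 'k \<Rightarrow> real ^ 'k ^ 'k" where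
  "d1 \<rho> q = (\<chi> \<alpha> \<beta>. pd \<alpha> (\<lambda>z. \<rho> z $ \<beta>) q - pd \<beta> (\<lambda>z. \<rho> z $ \<alpha>) q)"

definition wedge :: "real ^ 'k::finite \<Rightarrow> real ^ 'k \<Rightarrow> real ^ 'k ^ 'k" where
  "wedge \<rho> \<sigma> = (\<chi> \<alpha> \<beta>. \<rho> $ \<alpha> * \<sigma> $ \<beta> - \<rho> $ \<beta> * \<sigma> $ \<alpha>)"

definition coordinate_domain :: "(real ^ 'k::finite) set \<Rightarrow> bool" where
  "coordinate_domain U \<longleftrightarrow> open U \<and>
     (\<forall>\<rho>. smooth_form U \<rho> \<and> (\<forall>q\<in>U. d1 \<rho> q = 0) \<longrightarrow>
        (\<exists>f. smooth_fn U f \<and> (\<forall>q\<in>U. \<rho> q = d0 f q)))"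

section \<open>Cofactor systems\<close>

definition riemannian_metric :: "(real ^ 'k::finite) set \<Rightarrow> (real ^ 'k \<Rightarrow> real ^ 'k ^ 'k) \<Rightarrow> bool" where
  "riemannian_metric U g \<longleftrightarrow> smooth_tensor U g \<and>
     (\<forall>q\<in>U. transpose (g q) = g q \<and> (\<forall>v. v \<noteq> 0 \<longrightarrow> v \<bullet> (g q *v v) > 0))"

text \<open>\<open>christoffel g \<gamma> \<mu> \<alpha>\<close> is $\Gamma^\gamma_{\mu\alpha}$.\<close>

definition christoffel ::
    "(real ^ 'k::finite \<Rightarrow> real ^ 'k ^ 'k) \<Rightarrow> 'k \<Rightarrow> 'k \<Rightarrow> 'k \<Rightarrow> real ^ 'k \<Rightarrow> real" where
  "christoffel g \<gamma> \<mu> \<alpha> q = (1/2) * (\<Sum>\<delta>\<in>UNIV. matrix_inv (g q) $ \<gamma> $ \<delta> *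
     (pd \<mu> (\<lambda>z. g z $ \<delta> $ \<alpha>) q + pd \<alpha> (\<lambda>z. g z $ \<delta> $ \<mu>) q - pd \<delta> (\<lambda>z. g z $ \<mu> $ \<alpha>) q))"

text \<open>\<open>cov_deriv g S \<alpha> \<beta> \<gamma>\<close> is $S_{\alpha\beta|\gamma}$ for a twice covariant tensor \<open>S\<close>.\<close>

definition cov_deriv ::
    "(real ^ 'k::finite \<Rightarrow> real ^ 'k ^ 'k) \<Rightarrow> (real ^ 'k \<Rightarrow> real ^ 'k ^ 'k) \<Rightarrow>
      'k \<Rightarrow> 'k \<Rightarrow> 'k \<Rightarrow> real ^ 'k \<Rightarrow> real" where
  "cov_deriv g S \<alpha> \<beta> \<gamma> q = pd \<gamma> (\<lambda>z. S z $ \<alpha> $ \<beta>) q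
     - (\<Sum>\<mu>\<in>UNIV. christoffel g \<mu> \<alpha> \<gamma> q * S q $ \<mu> $ \<beta>)
     - (\<Sum>\<mu>\<in>UNIV. christoffel g \<mu> \<beta> \<gamma> q * S q $ \<alpha> $ \<mu>)"

text \<open>The matrix product \<open>g q ** J q\<close> is $J_{\alpha\beta} = g_{\alpha\gamma} J^\gamma_\beta$.\<close>

definition scKt :: "(real ^ 'k::finite) set \<Rightarrow> (real ^ 'k \<Rightarrow> real ^ 'k ^ 'k) \<Rightarrow>
    (real ^ 'k \<Rightarrow> real ^ 'k ^ 'k) \<Rightarrow> bool" where
  "scKt U g J \<longleftrightarrow> smooth_tensor U J \<and>
     (\<forall>q\<in>U. transpose (g q ** J q) = g q ** J q) \<and>
     (\<forall>q\<in>U. \<forall>\<alpha> \<beta> \<gamma>. cov_deriv g (\<lambda>z. g z ** J z) \<alpha> \<beta> \<gamma> q =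
        (1/2) * (d0 (\<lambda>z. trace (J z)) q $ \<alpha> * g q $ \<beta> $ \<gamma> +
                 d0 (\<lambda>z. trace (J z)) q $ \<beta> * g q $ \<alpha> $ \<gamma>))"

text \<open>
  $d_J$ on a 1-form $\rho = \rho_\gamma dq^\gamma$, evaluated by the derivation rule, by
  $d_J f = J(df)$ on functions, and by
  $d_J(dq^\gamma) = - d(d_J q^\gamma) = - d(J(dq^\gamma))$;
  \<open>axis \<gamma> 1\<close> is the 1-form $dq^\gamma$.
\<close>

definition d_J :: "(real ^ 'k::finite \<Rightarrow> real ^ 'k ^ 'k) \<Rightarrow> (real ^ 'k \<Rightarrow> real ^ 'k) \<Rightarrow>
    real ^ 'k \<Rightarrow> real ^ 'k ^ 'k" where
  "d_J J \<rho> q = (\<Sum>\<gamma>\<in>UNIV. wedge (d0 (\<lambda>z. \<rho> z $ \<gamma>) q v* J q) (axis \<gamma> 1)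
                         - \<rho> q $ \<gamma> *\<^sub>R d1 (\<lambda>z. axis \<gamma> 1 v* J z) q)"

definition D_J :: "(real ^ 'k::finite \<Rightarrow> real ^ 'k ^ 'k) \<Rightarrow> (real ^ 'k \<Rightarrow> real ^ 'k) \<Rightarrow>
    real ^ 'k \<Rightarrow> real ^ 'k ^ 'k" where
  "D_J J \<rho> q = d_J J \<rho> q + wedge (d0 (\<lambda>z. trace (J z)) q) (\<rho> q)"

definition cofactor_system :: "(real ^ 'k::finite) set \<Rightarrow> (real ^ 'k \<Rightarrow> real ^ 'k ^ 'k) \<Rightarrow>
    (real ^ 'k \<Rightarrow> real ^ 'k) \<Rightarrow> (real ^ 'k \<Rightarrow> real ^ 'k ^ 'k) \<Rightarrow> bool" where
  "cofactor_system U g \<mu> J \<longleftrightarrow>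
     riemannian_metric U g \<and> smooth_form U \<mu> \<and> scKt U g J \<and>
     (\<forall>q\<in>U. invertible (J q)) \<and> (\<forall>q\<in>U. D_J J \<mu> q = 0)"

text \<open>
  Coordinates $(y^i, x^a)$ are indexed by the sum type \<open>'m + 'n\<close>: \<open>q $ Inl i\<close> is $y^i$ and
  \<open>q $ Inr a\<close> is $x^a$.
\<close>

definition function_of_y :: "(real ^ ('m::finite + 'n::finite)) set \<Rightarrow>
    (real ^ ('m + 'n) \<Rightarrow> real) \<Rightarrow> bool" where
  "function_of_y U f \<longleftrightarrow> (\<forall>q\<in>U. \<forall>q'\<in>U. (\<forall>i. q $ Inl i = q' $ Inl i) \<longrightarrow> f q = f q')"

definition function_of_x :: "(real ^ ('m::finite + 'n::finite)) set \<Rightarrow>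
    (real ^ ('m + 'n) \<Rightarrow> real) \<Rightarrow> bool" where
  "function_of_x U f \<longleftrightarrow> (\<forall>q\<in>U. \<forall>q'\<in>U. (\<forall>a. q $ Inr a = q' $ Inr a) \<longrightarrow> f q = f q')"

definition driven_cofactor_system ::
    "(real ^ ('m::finite + 'n::finite)) set \<Rightarrow>
     (real ^ ('m + 'n) \<Rightarrow> real ^ ('m + 'n) ^ ('m + 'n)) \<Rightarrow>
     (real ^ ('m + 'n) \<Rightarrow> real ^ ('m + 'n)) \<Rightarrow>
     (real ^ ('m + 'n) \<Rightarrow> real ^ ('m + 'n) ^ ('m + 'n)) \<Rightarrow> bool" where
  "driven_cofactor_system U g \<mu> J \<longleftrightarrow>
     cofactor_system U g \<mu> J \<and>
     (\<forall>i j. function_of_y U (\<lambda>q. g q $ Inl i $ Inl j)) \<and>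
     (\<forall>a b. function_of_x U (\<lambda>q. g q $ Inr a $ Inr b)) \<and>
     (\<forall>q\<in>U. \<forall>i a. g q $ Inl i $ Inr a = 0 \<and> g q $ Inr a $ Inl i = 0) \<and>
     (\<forall>i. function_of_y U (\<lambda>q. \<mu> q $ Inl i)) \<and>
     (\<exists>V. smooth_fn U V \<and> (\<forall>q\<in>U. \<forall>a. \<mu> q $ Inr a = - pd (Inr a) V q)) \<and>
     (\<exists>q\<in>U. \<exists>a i. pd (Inl i) (\<lambda>z. \<mu> z $ Inr a) q \<noteq> 0)"

definition P2 :: "real ^ ('m::finite + 'n::finite) ^ ('m + 'n)" where
  "P2 = (\<chi> \<alpha> \<beta>. case \<alpha> of Inl i \<Rightarrow> 0 | Inr a \<Rightarrow> if \<beta> = Inr a then 1 else 0)"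

text \<open>The restriction of $J_1$ to $K^\perp$, as the matrix $J^i_j$.\<close>

definition J1_block :: "real ^ ('m::finite + 'n::finite) ^ ('m + 'n) \<Rightarrow> real ^ 'm ^ 'm" where
  "J1_block A = (\<chi> i j. A $ Inl i $ Inl j)"

section \<open>Cofactor tensors and the quadratic functions\<close>

text \<open>
  The adjugate: the \<open>(i, j)\<close> entry is the cofactor of the entry \<open>(j, i)\<close>, that is, the determinant
  of \<open>A\<close> with row \<open>j\<close> replaced by the \<open>i\<close>-th unit vector.
\<close>

definition cof :: "'a::comm_ring_1 ^ 'k::finite ^ 'k \<Rightarrow> 'a ^ 'k ^ 'k" where
  "cof A = (\<chi> i j. det (\<chi> k. if k = j then axis i 1 else row k A))"

text \<open>
  \<open>cof_pencil B\<close> is $\operatorname{cof}(B + a P_2)$ as a matrix of polynomials in the indeterminate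
  $a$, and \<open>A_coef i B\<close> is the coefficient of $a^{i-1}$.
\<close>

definition cof_pencil :: "real ^ ('m::finite + 'n::finite) ^ ('m + 'n) \<Rightarrow>
    (real poly) ^ ('m + 'n) ^ ('m + 'n)" where
  "cof_pencil B = cof (\<chi> \<alpha> \<beta>. [:B $ \<alpha> $ \<beta>, P2 $ \<alpha> $ \<beta>:])"

definition A_coef :: "nat \<Rightarrow> real ^ ('m::finite + 'n::finite) ^ ('m + 'n) \<Rightarrow>
    real ^ ('m + 'n) ^ ('m + 'n)" where
  "A_coef i B = (\<chi> \<alpha> \<beta>. coeff (cof_pencil B $ \<alpha> $ \<beta>) (i - 1))"

lemma cof_right:
  fixes A :: "'a::comm_ring_1 ^ 'k::finite ^ 'k"
  shows "A ** cof A = mat (det A)"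
proof -
  have "(A ** cof A) $ r $ j = mat (det A) $ r $ j" for r j
  proof -
    have "(A ** cof A) $ r $ j =
        (\<Sum>i\<in>UNIV. det (\<chi> k. if k = j then A $ r $ i *s axis i 1 else row k A))"
      by (simp add: matrix_matrix_mult_def cof_def det_row_mul)
    also have "\<dots> = det (\<chi> k. if k = j then (\<Sum>i\<in>UNIV. A $ r $ i *s axis i 1) else row k A)"
      by (simp add: det_linear_row_sum)
    also have "(\<Sum>i\<in>UNIV. A $ r $ i *s axis i 1) = row r A"
      by (simp add: vec_eq_iff row_def axis_def if_distrib cong: if_cong)
    also have "det (\<chi> k. if k = j then row r A else row k A) = mat (det A) $ r $ j"
    proof (cases "r = j")
      case True
      have "(\<chi> k. if k = j then row r A else row k A) = A"
        using True by (auto simp: vec_eq_iff row_def)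
      then show ?thesis using True by (simp add: mat_def)
    next
      case False
      then have "det (\<chi> k. if k = j then row r A else row k A) = 0"
        by (intro det_identical_rows[of r j]) (auto simp: row_def vec_eq_iff)
      then show ?thesis using False by (simp add: mat_def)
    qed
    finally show ?thesis .
  qed
  then show ?thesis by (simp add: vec_eq_iff)
qed

lemma A_coef_expansion:
  fixes B :: "real ^ ('m::finite + 'n::finite) ^ ('m + 'n)"
  shows "cof (B + a *\<^sub>R P2) = (\<Sum>i = 1..CARD('n) + 1. a ^ (i - 1) *\<^sub>R A_coef i B)"
proof -
  define M :: "'m + 'n \<Rightarrow> 'm + 'n \<Rightarrow> (real poly) ^ ('m + 'n) ^ ('m + 'n)" where
    "M = (\<lambda>\<alpha> \<beta>. \<chi> k. if k = \<beta> then axis \<alpha> 1 else row k (\<chi> \<alpha> \<beta>. [:B $ \<alpha> $ \<beta>, P2 $ \<alpha> $ \<beta>:]))"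
  have entry: "cof_pencil B $ \<alpha> $ \<beta> = det (M \<alpha> \<beta>)" for \<alpha> \<beta>
    by (simp add: cof_pencil_def cof_def M_def)
  have poly_M: "poly (M \<alpha> \<beta> $ k $ l) a =
      (\<chi> k. if k = \<beta> then axis \<alpha> 1 else row k (B + a *\<^sub>R P2)) $ k $ l" for \<alpha> \<beta> k l
    by (simp add: M_def row_def axis_def)
  have ev: "cof (B + a *\<^sub>R P2) $ \<alpha> $ \<beta> = poly (cof_pencil B $ \<alpha> $ \<beta>) a" for \<alpha> \<beta>
    unfolding entry det_def poly_sum poly_mult poly_prod poly_M
    by (simp add: cof_def det_def)
  have degM: "degree (M \<alpha> \<beta> $ k $ l) \<le> (case k of Inl _ \<Rightarrow> 0 | Inr _ \<Rightarrow> 1)" for \<alpha> \<beta> k l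
    by (auto simp: M_def row_def axis_def P2_def split: sum.splits)
  have card: "(\<Sum>k\<in>(UNIV :: ('m + 'n) set). case k of Inl _ \<Rightarrow> 0 | Inr _ \<Rightarrow> (1::nat)) = CARD('n)"
    by (simp add: UNIV_Plus_UNIV[symmetric] sum.Plus del: UNIV_Plus_UNIV)
  have deg: "degree (cof_pencil B $ \<alpha> $ \<beta>) \<le> CARD('n)" for \<alpha> \<beta>
  proof -
    have "degree (of_int (sign p) * (\<Prod>k\<in>UNIV. M \<alpha> \<beta> $ k $ p k)) \<le> CARD('n)" for p
    proof -
      have "degree (of_int (sign p) * (\<Prod>k\<in>UNIV. M \<alpha> \<beta> $ k $ p k))
          \<le> degree (of_int (sign p) :: real poly) + degree (\<Prod>k\<in>UNIV. M \<alpha> \<beta> $ k $ p k)"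
        by (rule degree_mult_le)
      also have "\<dots> = degree (\<Prod>k\<in>UNIV. M \<alpha> \<beta> $ k $ p k)" by simp
      also have "\<dots> \<le> (\<Sum>k\<in>UNIV. degree (M \<alpha> \<beta> $ k $ p k))"
        using degree_prod_sum_le[of UNIV "\<lambda>k. M \<alpha> \<beta> $ k $ p k"] by (simp add: o_def)
      also have "\<dots> \<le> (\<Sum>k\<in>(UNIV :: ('m + 'n) set). case k of Inl _ \<Rightarrow> 0 | Inr _ \<Rightarrow> 1)"
        by (rule sum_mono) (rule degM)
      finally show ?thesis using card by simp
    qed
    then show ?thesis unfolding entry det_def by (intro degree_sum_le) (auto simp: finite_permutations)
  qed
  have "poly (cof_pencil B $ \<alpha> $ \<beta>) a =
      (\<Sum>i = 1..CARD('n) + 1. a ^ (i - 1) * coeff (cof_pencil B $ \<alpha> $ \<beta>) (i - 1))" for \<alpha> \<beta>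
  proof -
    have "poly (cof_pencil B $ \<alpha> $ \<beta>) a = (\<Sum>i\<le>CARD('n). coeff (cof_pencil B $ \<alpha> $ \<beta>) i * a ^ i)"
      unfolding poly_altdef using deg
      by (intro sum.mono_neutral_left) (auto simp: coeff_eq_0)
    also have "\<dots> = (\<Sum>i = 1..CARD('n) + 1. a ^ (i - 1) * coeff (cof_pencil B $ \<alpha> $ \<beta>) (i - 1))"
      by (rule sum.reindex_bij_witness[of _ "\<lambda>i. i - 1" Suc]) auto
    finally show ?thesis .
  qed
  then show ?thesis by (simp add: vec_eq_iff ev A_coef_def)
qed

text \<open>A function \<open>W\<close> with $\rho = - dW$.\<close>

definition is_potential :: "(real ^ 'k::finite) set \<Rightarrow> (real ^ 'k \<Rightarrow> real ^ 'k) \<Rightarrow>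
    (real ^ 'k \<Rightarrow> real) \<Rightarrow> bool" where
  "is_potential U \<rho> W \<longleftrightarrow> smooth_fn U W \<and> (\<forall>q\<in>U. \<rho> q = - d0 W q)"

definition H_fn :: "(real ^ ('m::finite + 'n::finite) \<Rightarrow> real ^ ('m + 'n) ^ ('m + 'n)) \<Rightarrow>
    (real ^ ('m + 'n) \<Rightarrow> real ^ ('m + 'n) ^ ('m + 'n)) \<Rightarrow> nat \<Rightarrow>
    (real ^ ('m + 'n) \<Rightarrow> real) \<Rightarrow> (real ^ ('m + 'n)) \<times> (real ^ ('m + 'n)) \<Rightarrow> real" where
  "H_fn g J i W = (\<lambda>(q, p).
     (1/2) * (\<Sum>\<alpha>\<in>UNIV. \<Sum>\<beta>\<in>UNIV. (A_coef i (J q) ** matrix_inv (g q)) $ \<alpha> $ \<beta> * p $ \<alpha> * p $ \<beta>) + W q)"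

section \<open>Dynamics and Poisson brackets on the cotangent bundle\<close>

definition dq :: "'k::finite \<Rightarrow> ((real ^ 'k) \<times> (real ^ 'k) \<Rightarrow> real) \<Rightarrow>
    (real ^ 'k) \<times> (real ^ 'k) \<Rightarrow> real" where
  "dq \<alpha> F z = pd \<alpha> (\<lambda>q. F (q, snd z)) (fst z)"

definition dp :: "'k::finite \<Rightarrow> ((real ^ 'k) \<times> (real ^ 'k) \<Rightarrow> real) \<Rightarrow>
    (real ^ 'k) \<times> (real ^ 'k) \<Rightarrow> real" where
  "dp \<alpha> F z = pd \<alpha> (\<lambda>p. F (fst z, p)) (snd z)"

text \<open>The vector field \<open>Gamma_hat g \<mu>\<close> as a derivation on functions.\<close>

definition Gamma_hat :: "(real ^ 'k::finite \<Rightarrow> real ^ 'k ^ 'k) \<Rightarrow> (real ^ 'k \<Rightarrow> real ^ 'k) \<Rightarrow>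
    ((real ^ 'k) \<times> (real ^ 'k) \<Rightarrow> real) \<Rightarrow> (real ^ 'k) \<times> (real ^ 'k) \<Rightarrow> real" where
  "Gamma_hat g \<mu> F = (\<lambda>(q, p).
     (\<Sum>\<alpha>\<in>UNIV. (\<Sum>\<beta>\<in>UNIV. matrix_inv (g q) $ \<alpha> $ \<beta> * p $ \<beta>) * dq \<alpha> F (q, p)) +
     (\<Sum>\<alpha>\<in>UNIV. ((\<Sum>\<gamma>\<in>UNIV. \<Sum>\<nu>\<in>UNIV. \<Sum>\<delta>\<in>UNIV.
          christoffel g \<gamma> \<nu> \<alpha> q * matrix_inv (g q) $ \<nu> $ \<delta> * p $ \<gamma> * p $ \<delta>) + \<mu> q $ \<alpha>) * dp \<alpha> F (q, p)))"

definition first_integral :: "(real ^ 'k::finite) set \<Rightarrow> (real ^ 'k \<Rightarrow> real ^ 'k ^ 'k) \<Rightarrow>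
    (real ^ 'k \<Rightarrow> real ^ 'k) \<Rightarrow> ((real ^ 'k) \<times> (real ^ 'k) \<Rightarrow> real) \<Rightarrow> bool" where
  "first_integral U g \<mu> F \<longleftrightarrow> (\<forall>q\<in>U. \<forall>p. Gamma_hat g \<mu> F (q, p) = 0)"

text \<open>
  \<open>bivec X Y F G\<close> is $(X \wedge Y)(dF, dG)$ with $X \wedge Y = X \otimes Y - Y \otimes X$, and
  \<open>bracket J F G\<close> is $\{F, G\}_J = P_J(dF)(dG)$, contraction being in the first slot.
\<close>

definition bivec :: "(('z \<Rightarrow> real) \<Rightarrow> 'z \<Rightarrow> real) \<Rightarrow> (('z \<Rightarrow> real) \<Rightarrow> 'z \<Rightarrow> real) \<Rightarrow>
    ('z \<Rightarrow> real) \<Rightarrow> ('z \<Rightarrow> real) \<Rightarrow> 'z \<Rightarrow> real" where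
  "bivec X Y F G z = X F z * Y G z - Y F z * X G z"

definition bracket :: "(real ^ 'k::finite \<Rightarrow> real ^ 'k ^ 'k) \<Rightarrow>
    ((real ^ 'k) \<times> (real ^ 'k) \<Rightarrow> real) \<Rightarrow> ((real ^ 'k) \<times> (real ^ 'k) \<Rightarrow> real) \<Rightarrow>
    (real ^ 'k) \<times> (real ^ 'k) \<Rightarrow> real" where
  "bracket J F G = (\<lambda>(q, p).
     (\<Sum>\<alpha>\<in>UNIV. \<Sum>\<beta>\<in>UNIV. J q $ \<alpha> $ \<beta> * bivec (dp \<beta>) (dq \<alpha>) F G (q, p)) -
     (1/2) * (\<Sum>\<alpha>\<in>UNIV. \<Sum>\<beta>\<in>UNIV. \<Sum>\<gamma>\<in>UNIV. p $ \<gamma> *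
        (pd \<beta> (\<lambda>z. J z $ \<gamma> $ \<alpha>) q - pd \<alpha> (\<lambda>z. J z $ \<gamma> $ \<beta>) q) *
        bivec (dp \<alpha>) (dp \<beta>) F G (q, p)))"

end

theory Submission
  imports Defs
begin

text \<open>
  Since \<open>P2\<close> is parallel, \<open>J + a P2\<close> is a special conformal Killing tensor with the same differential of
  the trace $\alpha$ for every real \<open>a\<close>, and $D_{J + aP_2}\mu = 0$. Put
  $A = \operatorname{cof}(J + aP_2)$, $D = \det(J + aP_2)$, $u = g^{-1}p$ and $H = \frac12 \langle p, Au\rangle + W$
  with $dW = -A\mu$. Whenever $D \neq 0$, the fibre derivative of \<open>H\<close> is $Au$ and its horizontal derivative is
  $\frac{1}{2D}(\langle p, Au\rangle A\alpha - \langle\alpha, Au\rangle Ap) - A\mu$. Rewriting $\hat\Gamma$ and both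
  brackets in terms of fibre and horizontal derivatives turns the claims for a pair of parameters
  $a \neq b$, with cofactors $A$, $B$ and determinants $D$, $E$, into consequences of the single matrix
  identity $(b - a) B P_2 A = E A - D B$. All claims are polynomial in the parameters and hold at each
  point outside finitely many values of them, so they hold coefficientwise.
\<close>

section \<open>Partial derivatives and smoothness\<close>

text \<open>A single coefficient \<open>A_coef i (J q)\<close> is in general not the cofactor of a
  special conformal Killing tensor, so it has no closed formula for its derivative; only the whole
  pencil has one. That formula in turn comes from differentiating J cof J = (det J) I and is solved
  by dividing by the determinant, which is what excludes singular parameters. These vary with the
  point q. Coefficients are therefore compared over one fixed q, after all differentiations; since
  det J is nonzero there, the determinant of the pencil is a nonzero polynomial in the parameter.
  Horizontal derivatives are chosen because all Christoffel symbols cancel in them: what remains is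
  linear algebra in one tangent space, and no special coordinates at a point are needed. The matrix
  identity is a resolvent identity: insert (b - a) P2 = (J + b P2) - (J + a P2) between the two
  cofactors. It is empty for a = b, so the diagonal has to be recovered from the coefficients in the
  end.\<close>

lemma pd_cong:
  assumes "open U" "q \<in> U" "\<And>z. z \<in> U \<Longrightarrow> f z = h z"
  shows "pd \<alpha> f q = pd \<alpha> h q"
proof -
  \<comment> \<open>\<open>frechet_derivative\<close> is a choice among all derivatives
    \<open>F\<close>, so an equivalence for every \<open>F\<close> makes the two choices agree even
    where no derivative exists.\<close>
  have "(f has_derivative F) (at q) \<longleftrightarrow> (h has_derivative F) (at q)" for F
    using assms has_derivative_transform_within_open[of f F q UNIV U h]
      has_derivative_transform_within_open[of h F q UNIV U f] by auto
  then show ?thesis by (simp add: pd_def frechet_derivative_def)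
qed

lemma pd_eqI: "(f has_derivative F) (at q) \<Longrightarrow> pd \<alpha> f q = F (axis \<alpha> 1)"
  by (simp add: pd_def frechet_derivative_at[symmetric])

lemma differentiable_imp_pd: "f differentiable (at q) \<Longrightarrow> (f has_derivative frechet_derivative f (at q)) (at q)"
  by (simp add: frechet_derivative_works)

lemma pd_const [simp]: "pd \<alpha> (\<lambda>_. c) q = 0"
  by (simp add: pd_def)

lemma pd_add:
  assumes "f differentiable (at q)" "h differentiable (at q)"
  shows "pd \<alpha> (\<lambda>z. f z + h z) q = pd \<alpha> f q + pd \<alpha> h q"
  using pd_eqI[OF has_derivative_add[OF assms[THEN differentiable_imp_pd]]] by (simp add: pd_def)

lemma pd_uminus:
  assumes "f differentiable (at q)"
  shows "pd \<alpha> (\<lambda>z. - f z) q = - pd \<alpha> f q"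
  using pd_eqI[OF has_derivative_minus[OF assms[THEN differentiable_imp_pd]]] by (simp add: pd_def)

lemma pd_mult:
  assumes "f differentiable (at q)" "h differentiable (at q)"
  shows "pd \<alpha> (\<lambda>z. f z * h z) q = pd \<alpha> f q * h q + f q * pd \<alpha> h q"
  using pd_eqI[OF has_derivative_mult[OF assms[THEN differentiable_imp_pd]]] by (simp add: pd_def)

lemma pd_cmult:
  assumes "f differentiable (at q)"
  shows "pd \<alpha> (\<lambda>z. c * f z) q = c * pd \<alpha> f q"
  using pd_mult[of "\<lambda>_. c" q f] assms by simp

lemma pd_sum:
  assumes "\<And>i. i \<in> I \<Longrightarrow> f i differentiable (at q)"
  shows "pd \<alpha> (\<lambda>z. \<Sum>i\<in>I. f i z) q = (\<Sum>i\<in>I. pd \<alpha> (f i) q)"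
proof -
  have "((\<lambda>z. \<Sum>i\<in>I. f i z) has_derivative (\<lambda>v. \<Sum>i\<in>I. frechet_derivative (f i) (at q) v)) (at q)"
    by (intro has_derivative_sum differentiable_imp_pd assms)
  from pd_eqI[OF this] show ?thesis by (simp add: pd_def)
qed

lemma differentiable_nth: "(\<lambda>z. z $ \<beta>) differentiable (at (q :: real ^ 'k::finite))"
  using bounded_linear_imp_differentiable bounded_linear_vec_nth by blast

section \<open>Closure properties of smooth functions\<close>

text \<open>The rules for \<open>pd\<close> of a sum or a product hold only on \<open>U\<close>,
  where differentiability is known. This carries the class over from the formula to the actual
  partial derivative.\<close>

lemma Ck_fn_cong:
  assumes "open U" "\<And>z. z \<in> U \<Longrightarrow> f z = h z" "Ck_fn r U f"
  shows "Ck_fn r U h"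
  using assms(2,3)
proof (induction r arbitrary: f h)
  case 0
  then show ?case using continuous_on_cong[of U U f h] by simp
next
  case (Suc r)
  have "h differentiable (at q)" if "q \<in> U" for q
  proof -
    have "(f has_derivative frechet_derivative f (at q)) (at q)"
      using Suc.prems that by (auto intro: differentiable_imp_pd)
    then have "(h has_derivative frechet_derivative f (at q)) (at q)"
      by (rule has_derivative_transform_within_open[OF _ assms(1) that]) (auto simp: Suc.prems)
    then show ?thesis by (auto simp: differentiable_def)
  qed
  moreover have "Ck_fn r U (pd \<alpha> h)" for \<alpha>
  proof (rule Suc.IH[of "pd \<alpha> f"])
    show "pd \<alpha> f z = pd \<alpha> h z" if "z \<in> U" for z
      by (rule pd_cong[OF assms(1) that Suc.prems(1)])
    show "Ck_fn r U (pd \<alpha> f)" using Suc.prems(2) by simp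
  qed
  ultimately show ?case by simp
qed

lemma Ck_fn_Suc_imp: "Ck_fn (Suc r) U f \<Longrightarrow> Ck_fn r U f"
proof (induction r arbitrary: f)
  case 0
  then show ?case
    by (auto intro!: continuous_at_imp_continuous_on differentiable_imp_continuous_within)
next
  case (Suc r)
  then have "\<And>\<alpha>. Ck_fn (Suc r) U (pd \<alpha> f)" unfolding Ck_fn.simps(2)[of "Suc r"] by blast
  moreover have "\<forall>q\<in>U. f differentiable (at q)" using Suc.prems unfolding Ck_fn.simps(2)[of "Suc r"] by blast
  ultimately show ?case using Suc.IH unfolding Ck_fn.simps(2)[of r] by blast
qed

lemma Ck_fn_const: "Ck_fn r U (\<lambda>_. c)"
proof (induction r arbitrary: c)
  case (Suc r)
  moreover have "pd \<alpha> (\<lambda>_. c) = (\<lambda>_. 0)" for \<alpha> :: 'a by (auto simp: pd_def)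
  ultimately show ?case by simp
qed simp

lemma Ck_fn_add:
  assumes "open U" "Ck_fn r U f" "Ck_fn r U h"
  shows "Ck_fn r U (\<lambda>z. f z + h z)"
  using assms(2,3)
proof (induction r arbitrary: f h)
  case 0
  then show ?case by (simp add: continuous_on_add)
next
  case (Suc r)
  have "Ck_fn r U (\<lambda>z. pd \<alpha> f z + pd \<alpha> h z)" for \<alpha>
    using Suc.prems by (intro Suc.IH) auto
  then have "Ck_fn r U (pd \<alpha> (\<lambda>z. f z + h z))" for \<alpha>
    by (rule Ck_fn_cong[OF assms(1), rotated]) (use Suc.prems in \<open>simp add: pd_add\<close>)
  then show ?case using Suc.prems by (auto intro: differentiable_add)
qed

lemma Ck_fn_mult:
  assumes "open U" "Ck_fn r U f" "Ck_fn r U h"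
  shows "Ck_fn r U (\<lambda>z. f z * h z)"
  using assms(2,3)
proof (induction r arbitrary: f h)
  case 0
  then show ?case by (simp add: continuous_on_mult)
next
  case (Suc r)
  \<comment> \<open>The undifferentiated factors are of class \<open>Suc r\<close> and must be
    lowered to class \<open>r\<close> before the induction hypothesis applies.\<close>
  have "Ck_fn r U (\<lambda>z. pd \<alpha> f z * h z + f z * pd \<alpha> h z)" for \<alpha>
    using Suc.prems Suc.prems[THEN Ck_fn_Suc_imp] by (intro Ck_fn_add[OF assms(1)] Suc.IH) auto
  then have "Ck_fn r U (pd \<alpha> (\<lambda>z. f z * h z))" for \<alpha>
    by (rule Ck_fn_cong[OF assms(1), rotated]) (use Suc.prems in \<open>simp add: pd_mult\<close>)
  then show ?case using Suc.prems by (auto intro: differentiable_mult)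
qed

lemma smooth_fn_const: "smooth_fn U (\<lambda>_. c)"
  and smooth_fn_add: "open U \<Longrightarrow> smooth_fn U f \<Longrightarrow> smooth_fn U h \<Longrightarrow> smooth_fn U (\<lambda>z. f z + h z)"
  and smooth_fn_mult: "open U \<Longrightarrow> smooth_fn U f \<Longrightarrow> smooth_fn U h \<Longrightarrow> smooth_fn U (\<lambda>z. f z * h z)"
  by (auto simp: smooth_fn_def Ck_fn_const Ck_fn_add Ck_fn_mult)

lemma smooth_fn_sum:
  assumes "open U" "\<And>i. i \<in> I \<Longrightarrow> smooth_fn U (f i)"
  shows "smooth_fn U (\<lambda>z. \<Sum>i\<in>I. f i z)"
  using assms(2) by (induction I rule: infinite_finite_induct)
    (auto simp: smooth_fn_const intro: smooth_fn_add[OF assms(1)])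

lemma smooth_fn_differentiable: "smooth_fn U f \<Longrightarrow> q \<in> U \<Longrightarrow> f differentiable (at q)"
  unfolding smooth_fn_def using Ck_fn.simps(2)[of 0 U f] by blast

text \<open>By the Leibniz formula and convolution of coefficients, this is a polynomial in the
  coefficients of the entries. No quotient occurs, so nonsingularity is not an issue here.\<close>

lemma smooth_fn_coeff_det:
  fixes M :: "real ^ 'k::finite \<Rightarrow> real poly ^ 'n::finite ^ 'n"
  assumes "open U" and M: "\<And>i j d. smooth_fn U (\<lambda>z. coeff (M z $ i $ j) d)"
  shows "smooth_fn U (\<lambda>z. coeff (det (M z)) d)"
proof -
  have mult: "smooth_fn U (\<lambda>z. coeff (f z * h z) d)"
    if "\<And>d. smooth_fn U (\<lambda>z. coeff (f z) d)" "\<And>d. smooth_fn U (\<lambda>z. coeff (h z) d)"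
    for f h :: "real ^ 'k \<Rightarrow> real poly" and d
    using that unfolding coeff_mult by (intro smooth_fn_sum smooth_fn_mult assms(1))
  have prod: "smooth_fn U (\<lambda>z. coeff (\<Prod>i\<in>I. f i z) d)"
    if "\<And>i d. smooth_fn U (\<lambda>z. coeff (f i z) d)" for I and f :: "'n \<Rightarrow> real ^ 'k \<Rightarrow> real poly" and d
    using finite[of I] by (induction I arbitrary: d) (auto simp: smooth_fn_const intro!: mult that)
  show ?thesis
    unfolding det_def coeff_sum by (intro smooth_fn_sum mult prod M smooth_fn_const assms(1))
qed

lemma smooth_fn_A_coef:
  fixes J :: "real ^ ('m::finite + 'n::finite) \<Rightarrow> real ^ ('m + 'n) ^ ('m + 'n)"
  assumes "open U" "smooth_tensor U J"
  shows "smooth_fn U (\<lambda>z. A_coef i (J z) $ \<alpha> $ \<beta>)"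
proof -
  have "smooth_fn U (\<lambda>z. coeff [:J z $ \<kappa> $ \<nu>, P2 $ \<kappa> $ \<nu>:] d)" for \<kappa> \<nu> d
    using assms(2) by (cases d)
      (simp_all add: smooth_tensor_def smooth_fn_const coeff_pCons split: nat.split)
  then have "smooth_fn U (\<lambda>z. coeff ((\<chi> k. if k = \<beta> then axis \<alpha> 1
      else row k (\<chi> \<alpha> \<beta>. [:J z $ \<alpha> $ \<beta>, P2 $ \<alpha> $ \<beta>:])) $ k $ j) d)" for k j d
    by (cases "k = \<beta>") (simp_all add: row_def smooth_fn_const)
  from smooth_fn_coeff_det[OF assms(1) this] show ?thesis
    by (simp add: A_coef_def cof_pencil_def cof_def)
qed

section \<open>Symmetry of second partial derivatives\<close>

lemma has_real_derivative_pd: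
  fixes f :: "real ^ 'k::finite \<Rightarrow> real"
  assumes "f differentiable (at (z + s *\<^sub>R axis \<alpha> 1))"
  shows "((\<lambda>s. f (z + s *\<^sub>R axis \<alpha> 1)) has_real_derivative pd \<alpha> f (z + s *\<^sub>R axis \<alpha> 1)) (at s)"
proof -
  let ?F = "frechet_derivative f (at (z + s *\<^sub>R axis \<alpha> 1))"
  have F: "(f has_derivative ?F) (at (z + s *\<^sub>R axis \<alpha> 1))"
    using assms by (rule differentiable_imp_pd)
  have "((\<lambda>s. z + s *\<^sub>R axis \<alpha> 1) has_derivative (\<lambda>t. t *\<^sub>R axis \<alpha> 1)) (at s)"
    by (auto intro!: derivative_eq_intros)
  from has_derivative_compose[OF this F]
  have "((\<lambda>s. f (z + s *\<^sub>R axis \<alpha> 1)) has_derivative (\<lambda>t. ?F (t *\<^sub>R axis \<alpha> 1))) (at s)" .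
  moreover have "?F (t *\<^sub>R axis \<alpha> 1) = pd \<alpha> f (z + s *\<^sub>R axis \<alpha> 1) * t" for t
    using linear_scale[OF has_derivative_linear[OF F]] by (simp add: pd_def)
  ultimately show ?thesis by (simp add: has_field_derivative_def)
qed

text \<open>The left-hand side is symmetric in $\alpha$ and $\beta$, so letting $t \to 0$ makes the mixed partial
  derivatives equal.\<close>

lemma second_difference:
  fixes f :: "real ^ 'k::finite \<Rightarrow> real"
  assumes "ball q r \<subseteq> U" "0 < t" "2 * t < r"
    and f: "\<And>z. z \<in> U \<Longrightarrow> f differentiable (at z)"
    and f': "\<And>z. z \<in> U \<Longrightarrow> pd \<alpha> f differentiable (at z)"
  obtains z where "z \<in> ball q r"
    "f (q + t *\<^sub>R axis \<alpha> 1 + t *\<^sub>R axis \<beta> 1) - f (q + t *\<^sub>R axis \<alpha> 1) - f (q + t *\<^sub>R axis \<beta> 1) + f q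
      = t\<^sup>2 * pd \<beta> (pd \<alpha> f) z"
proof -
  define a where "a = (axis \<alpha> 1 :: real ^ 'k)"
  define b where "b = (axis \<beta> 1 :: real ^ 'k)"
  have inB: "q + x *\<^sub>R a + y *\<^sub>R b \<in> ball q r" if "0 \<le> x" "x \<le> t" "0 \<le> y" "y \<le> t" for x y
  proof -
    have "norm (x *\<^sub>R a + y *\<^sub>R b) \<le> norm (x *\<^sub>R a) + norm (y *\<^sub>R b)" by (rule norm_triangle_ineq)
    also have "\<dots> = x + y" using that by (simp add: a_def b_def)
    also have "\<dots> < r" using that assms by linarith
    finally show ?thesis by (simp add: dist_norm norm_minus_commute algebra_simps)
  qed
  have inU: "q + x *\<^sub>R a + y *\<^sub>R b \<in> U" if "0 \<le> x" "x \<le> t" "0 \<le> y" "y \<le> t" for x y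
    using inB[OF that] assms(1) by auto
  have d1: "((\<lambda>x. f (q + x *\<^sub>R a + y *\<^sub>R b)) has_real_derivative pd \<alpha> f (q + x *\<^sub>R a + y *\<^sub>R b)) (at x)"
    if "0 \<le> x" "x \<le> t" "0 \<le> y" "y \<le> t" for x y
  proof -
    have swap: "q + x *\<^sub>R a + y *\<^sub>R b = q + y *\<^sub>R b + x *\<^sub>R axis \<alpha> 1" for x
      by (simp add: a_def)
    show ?thesis
      using has_real_derivative_pd[of f "q + y *\<^sub>R b" x \<alpha>] f[OF inU[OF that]] unfolding swap by simp
  qed
  have d2: "((\<lambda>y. pd \<alpha> f (q + x *\<^sub>R a + y *\<^sub>R b)) has_real_derivative pd \<beta> (pd \<alpha> f) (q + x *\<^sub>R a + y *\<^sub>R b)) (at y)"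
    if "0 \<le> x" "x \<le> t" "0 \<le> y" "y \<le> t" for x y
    using has_real_derivative_pd[of "pd \<alpha> f" "q + x *\<^sub>R a" y \<beta>] f'[OF inU[OF that]]
    by (simp add: b_def)
  \<comment> \<open>The second difference is the increment of \<open>?g\<close> over [0, t]. The
    mean value theorem in x, then in y, produces the mixed derivative; the summand with factor 0
    keeps both terms in the shape covered by \<open>d1\<close>.\<close>
  let ?g = "\<lambda>x. f (q + x *\<^sub>R a + t *\<^sub>R b) - f (q + x *\<^sub>R a + 0 *\<^sub>R b)"
  obtain x where x: "0 < x" "x < t"
    "?g t - ?g 0 = (t - 0) * (pd \<alpha> f (q + x *\<^sub>R a + t *\<^sub>R b) - pd \<alpha> f (q + x *\<^sub>R a + 0 *\<^sub>R b))"
  proof -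
    have "(?g has_real_derivative pd \<alpha> f (q + x *\<^sub>R a + t *\<^sub>R b) - pd \<alpha> f (q + x *\<^sub>R a + 0 *\<^sub>R b)) (at x)"
      if "0 \<le> x" "x \<le> t" for x
      using that assms(2) by (intro DERIV_diff d1) auto
    from MVT2[OF assms(2) this] show ?thesis using that by blast
  qed
  obtain y where y: "0 < y" "y < t"
    "pd \<alpha> f (q + x *\<^sub>R a + t *\<^sub>R b) - pd \<alpha> f (q + x *\<^sub>R a + 0 *\<^sub>R b) = (t - 0) * pd \<beta> (pd \<alpha> f) (q + x *\<^sub>R a + y *\<^sub>R b)"
    using MVT2[OF assms(2), of "\<lambda>y. pd \<alpha> f (q + x *\<^sub>R a + y *\<^sub>R b)" "\<lambda>y. pd \<beta> (pd \<alpha> f) (q + x *\<^sub>R a + y *\<^sub>R b)"]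
      d2 x by auto
  show thesis
  proof (rule that)
    show "q + x *\<^sub>R a + y *\<^sub>R b \<in> ball q r" using x y by (intro inB) auto
    show "f (q + t *\<^sub>R axis \<alpha> 1 + t *\<^sub>R axis \<beta> 1) - f (q + t *\<^sub>R axis \<alpha> 1) - f (q + t *\<^sub>R axis \<beta> 1) + f q
      = t\<^sup>2 * pd \<beta> (pd \<alpha> f) (q + x *\<^sub>R a + y *\<^sub>R b)"
      using x(3) y(3) by (simp add: a_def b_def power2_eq_square algebra_simps)
  qed
qed

lemma pd_commute:
  fixes f :: "real ^ 'k::finite \<Rightarrow> real"
  assumes "open U" "q \<in> U" "smooth_fn U f"
  shows "pd \<beta> (pd \<alpha> f) q = pd \<alpha> (pd \<beta> f) q"
proof (rule ccontr)
  let ?F = "pd \<beta> (pd \<alpha> f)" and ?G = "pd \<alpha> (pd \<beta> f)"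
  assume "?F q \<noteq> ?G q"
  \<comment> \<open>Half the gap: the mixed derivatives at the two intermediate points coincide and
    each is within \<open>e\<close> of its value at \<open>q\<close>, so the values at
    \<open>q\<close> differ by less than 2 e. A single small t is enough, without a limit.\<close>
  define e where "e = \<bar>?F q - ?G q\<bar> / 2"
  have e: "e > 0" using \<open>?F q \<noteq> ?G q\<close> by (simp add: e_def)
  have C2: "Ck_fn (Suc (Suc 0)) U f" using assms(3) unfolding smooth_fn_def by blast
  then have diff: "f differentiable (at z)" "pd \<gamma> f differentiable (at z)" if "z \<in> U" for z \<gamma>
    using that by auto
  have cont: "continuous (at q) (pd \<gamma> (pd \<delta> f))" for \<gamma> \<delta>
  proof -
    have "continuous_on U (pd \<gamma> (pd \<delta> f))" using C2 by simp
    then show ?thesis using continuous_on_eq_continuous_at[OF assms(1)] assms(2) by blast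
  qed
  obtain r1 where r1: "r1 > 0" "\<And>z. dist z q < r1 \<Longrightarrow> dist (?F z) (?F q) < e"
    using cont[of \<beta> \<alpha>] e unfolding continuous_at_eps_delta by blast
  obtain r2 where r2: "r2 > 0" "\<And>z. dist z q < r2 \<Longrightarrow> dist (?G z) (?G q) < e"
    using cont[of \<alpha> \<beta>] e unfolding continuous_at_eps_delta by blast
  obtain r3 where r3: "r3 > 0" "ball q r3 \<subseteq> U"
    using assms(1,2) open_contains_ball by blast
  define r where "r = min r1 (min r2 r3)"
  have r: "r > 0" "ball q r \<subseteq> U" using r1(1) r2(1) r3 by (auto simp: r_def)
  define t where "t = r / 3"
  have t: "0 < t" "2 * t < r" using r(1) by (auto simp: t_def)
  obtain z where z: "z \<in> ball q r"
    "f (q + t *\<^sub>R axis \<alpha> 1 + t *\<^sub>R axis \<beta> 1) - f (q + t *\<^sub>R axis \<alpha> 1) - f (q + t *\<^sub>R axis \<beta> 1) + f q = t\<^sup>2 * ?F z"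
    using second_difference[OF r(2) t diff, where \<alpha>=\<alpha> and \<beta>=\<beta>] by metis
  obtain w where w: "w \<in> ball q r"
    "f (q + t *\<^sub>R axis \<beta> 1 + t *\<^sub>R axis \<alpha> 1) - f (q + t *\<^sub>R axis \<beta> 1) - f (q + t *\<^sub>R axis \<alpha> 1) + f q = t\<^sup>2 * ?G w"
    using second_difference[OF r(2) t diff, where \<alpha>=\<beta> and \<beta>=\<alpha>] by metis
  have swap: "q + t *\<^sub>R axis \<beta> 1 + t *\<^sub>R axis \<alpha> 1 = q + t *\<^sub>R axis \<alpha> 1 + t *\<^sub>R axis \<beta> 1"
    by (simp add: add.commute add.left_commute)
  have "t\<^sup>2 * ?F z = t\<^sup>2 * ?G w"
    using z(2) w(2) unfolding swap by linarith
  then have "?F z = ?G w" using t by simp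
  moreover have "dist (?F z) (?F q) < e" "dist (?G w) (?G q) < e"
    using r1(2)[of z] r2(2)[of w] z(1) w(1) by (auto simp: r_def dist_commute)
  ultimately show False unfolding e_def dist_real_def by (simp add: abs_if field_simps split: if_splits)
qed

text \<open>Turns dependence on \<open>y\<close> alone or on \<open>x\<close> alone into vanishing
  partial derivatives. The line may leave \<open>U\<close> and return, but only its part in a small
  ball around \<open>q\<close> matters.\<close>

lemma pd_eq_0_if_constant_along:
  fixes f :: "real ^ 'k::finite \<Rightarrow> real"
  assumes "open U" "q \<in> U" "f differentiable (at q)"
    and const: "\<And>t. q + t *\<^sub>R axis \<alpha> 1 \<in> U \<Longrightarrow> f (q + t *\<^sub>R axis \<alpha> 1) = f q"
  shows "pd \<alpha> f q = 0"
proof -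
  obtain r where r: "r > 0" "ball q r \<subseteq> U"
    using assms(1,2) open_contains_ball by blast
  have "((\<lambda>s. f (q + s *\<^sub>R axis \<alpha> 1)) has_real_derivative pd \<alpha> f (q + 0 *\<^sub>R axis \<alpha> 1)) (at 0)"
    by (rule has_real_derivative_pd) (simp add: assms(3))
  then show ?thesis
    using DERIV_local_const[of "\<lambda>s. f (q + s *\<^sub>R axis \<alpha> 1)" "pd \<alpha> f q" 0 r] r const
    by (auto simp: subset_eq dist_norm)
qed

section \<open>Derivatives of matrix-valued functions\<close>

definition mpd :: "'k::finite \<Rightarrow> (real ^ 'k \<Rightarrow> real ^ 'a::finite ^ 'b::finite) \<Rightarrow> real ^ 'k \<Rightarrow> real ^ 'a ^ 'b" where
  "mpd \<gamma> S q = (\<chi> \<alpha> \<beta>. pd \<gamma> (\<lambda>z. S z $ \<alpha> $ \<beta>) q)"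

definition entries_differentiable :: "(real ^ 'k::finite \<Rightarrow> real ^ 'a::finite ^ 'b::finite) \<Rightarrow> real ^ 'k \<Rightarrow> bool" where
  "entries_differentiable S q \<longleftrightarrow> (\<forall>\<alpha> \<beta>. (\<lambda>z. S z $ \<alpha> $ \<beta>) differentiable (at q))"

lemma mpd_cong:
  assumes "open U" "q \<in> U" "\<And>z. z \<in> U \<Longrightarrow> S z = T z"
  shows "mpd \<gamma> S q = mpd \<gamma> T q"
  by (simp add: mpd_def vec_eq_iff) (intro allI pd_cong[OF assms(1,2)], simp add: assms(3))

lemma mpd_mult:
  assumes "entries_differentiable S q" "entries_differentiable T q"
  shows "mpd \<gamma> (\<lambda>z. S z ** T z) q = mpd \<gamma> S q ** T q + S q ** mpd \<gamma> T q"
proof -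
  have "pd \<gamma> (\<lambda>z. (S z ** T z) $ \<alpha> $ \<beta>) q
      = (\<Sum>k\<in>UNIV. pd \<gamma> (\<lambda>z. S z $ \<alpha> $ k * T z $ k $ \<beta>) q)" for \<alpha> \<beta>
    unfolding matrix_matrix_mult_def vec_lambda_beta
    by (rule pd_sum) (use assms in \<open>auto simp: entries_differentiable_def intro!: differentiable_mult\<close>)
  also have "\<dots> \<alpha> \<beta> = (\<Sum>k\<in>UNIV. pd \<gamma> (\<lambda>z. S z $ \<alpha> $ k) q * T q $ k $ \<beta> + S q $ \<alpha> $ k * pd \<gamma> (\<lambda>z. T z $ k $ \<beta>) q)" for \<alpha> \<beta>
    using assms by (intro sum.cong refl pd_mult) (auto simp: entries_differentiable_def)
  finally show ?thesis
    by (simp add: mpd_def vec_eq_iff matrix_matrix_mult_def sum.distrib)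
qed

section \<open>Derivatives of determinant, cofactor and inverse\<close>

text \<open>Jacobi's formula, valid also at singular matrices. The product rule in the Leibniz
  formula differentiates one row at a time; expanding the differentiated row in unit vectors yields
  the cofactors.\<close>

lemma pd_det:
  fixes S :: "real ^ 'k::finite \<Rightarrow> real ^ 'n::finite ^ 'n"
  assumes "entries_differentiable S q"
  shows "(\<lambda>z. det (S z)) differentiable (at q)"
    and "pd \<gamma> (\<lambda>z. det (S z)) q = trace (cof (S q) ** mpd \<gamma> S q)"
proof -
  define d where "d i j = frechet_derivative (\<lambda>z. S z $ i $ j) (at q)" for i j
  have d: "((\<lambda>z. S z $ i $ j) has_derivative d i j) (at q)" for i j
    using assms unfolding d_def entries_differentiable_def by (intro differentiable_imp_pd) auto
  let ?P = "{p. p permutes (UNIV :: 'n set)}"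
  have D: "((\<lambda>z. det (S z)) has_derivative (\<lambda>v. \<Sum>p\<in>?P. of_int (sign p) *
      (\<Sum>k\<in>UNIV. d k (p k) v * (\<Prod>l\<in>UNIV - {k}. S q $ l $ p l)))) (at q)"
    unfolding det_def by (intro has_derivative_sum has_derivative_mult_right has_derivative_prod d)
  then show "(\<lambda>z. det (S z)) differentiable (at q)" by (auto simp: differentiable_def)
  let ?M = "mpd \<gamma> S q"
  have M: "d k j (axis \<gamma> 1) = ?M $ k $ j" for k j by (simp add: d_def mpd_def pd_def)
  have "pd \<gamma> (\<lambda>z. det (S z)) q = (\<Sum>k\<in>UNIV. \<Sum>p\<in>?P. of_int (sign p) *
      (?M $ k $ p k * (\<Prod>l\<in>UNIV - {k}. S q $ l $ p l)))"
    by (simp add: pd_eqI[OF D] M sum_distrib_left sum.swap[of _ ?P])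
  also have "\<dots> = (\<Sum>k\<in>UNIV. det (\<chi> l. if l = k then row k ?M else row l (S q)))"
    unfolding det_def
  proof (intro sum.cong refl)
    fix k p
    show "real_of_int (sign p) * (?M $ k $ p k * (\<Prod>l\<in>UNIV - {k}. S q $ l $ p l)) = of_int (sign p) *
        (\<Prod>i\<in>UNIV. (\<chi> l. if l = k then row k ?M else row l (S q)) $ i $ p i)"
      by (simp add: prod.remove[of UNIV k] row_def)
  qed
  also have "\<dots> = (\<Sum>k\<in>UNIV. \<Sum>j\<in>UNIV. ?M $ k $ j * cof (S q) $ j $ k)"
  proof (rule sum.cong[OF refl])
    fix k
    have "row k ?M = (\<Sum>j\<in>UNIV. ?M $ k $ j *s axis j 1)"
      by (simp add: vec_eq_iff row_def axis_def if_distrib cong: if_cong)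
    then show "det (\<chi> l. if l = k then row k ?M else row l (S q)) = (\<Sum>j\<in>UNIV. ?M $ k $ j * cof (S q) $ j $ k)"
      by (simp only: det_linear_row_sum finite det_row_mul cof_def vec_lambda_beta)
  qed
  also have "\<dots> = trace (cof (S q) ** ?M)"
    by (simp add: trace_def matrix_matrix_mult_def) (subst sum.swap, simp add: mult.commute)
  finally show "pd \<gamma> (\<lambda>z. det (S z)) q = trace (cof (S q) ** ?M)" .
qed

lemma entries_differentiable_cof:
  fixes S :: "real ^ 'k::finite \<Rightarrow> real ^ 'n::finite ^ 'n"
  assumes "entries_differentiable S q"
  shows "entries_differentiable (\<lambda>z. cof (S z)) q"
  unfolding entries_differentiable_def
proof (intro allI)
  fix \<alpha> \<beta>
  have "(\<lambda>z. (\<chi> k. if k = \<beta> then axis \<alpha> 1 else row k (S z)) $ i $ j) differentiable (at q)" for i j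
    using assms by (cases "i = \<beta>") (simp_all add: entries_differentiable_def row_def)
  then have "entries_differentiable (\<lambda>z. \<chi> k. if k = \<beta> then axis \<alpha> 1 else row k (S z)) q"
    unfolding entries_differentiable_def by blast
  from pd_det(1)[OF this] show "(\<lambda>z. cof (S z) $ \<alpha> $ \<beta>) differentiable (at q)"
    by (simp add: cof_def)
qed

text \<open>\<open>cof_right\<close> makes cof A / det A a right inverse, and a one-sided inverse of
  a square matrix is two-sided.\<close>

lemma cof_left:
  fixes A :: "real ^ 'k::finite ^ 'k"
  assumes "det A \<noteq> 0"
  shows "cof A ** A = mat (det A)"
proof -
  have mat_det: "mat (det A) = det A *\<^sub>R (mat 1 :: real ^ 'k ^ 'k)" by (simp add: mat_def vec_eq_iff)
  have "A ** ((1 / det A) *\<^sub>R cof A) = mat 1"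
    using assms by (simp add: matrix_scalar_ac scalar_matrix_assoc[symmetric] cof_right mat_det)
  then have "((1 / det A) *\<^sub>R cof A) ** A = mat 1" by (simp add: matrix_left_right_inverse)
  then have "det A *\<^sub>R (((1 / det A) *\<^sub>R cof A) ** A) = mat (det A)" by (simp add: mat_det)
  then show ?thesis using assms by (simp add: scalar_matrix_assoc[symmetric])
qed

lemma matrix_inv_left: "invertible A \<Longrightarrow> matrix_inv A ** A = mat 1"
  and matrix_inv_right: "invertible A \<Longrightarrow> A ** matrix_inv A = mat 1"
  unfolding invertible_def matrix_inv_def by (metis (mono_tags, lifting) someI_ex)+

lemma matrix_inv_eq_cof:
  fixes A :: "real ^ 'k::finite ^ 'k"
  assumes "det A \<noteq> 0"
  shows "matrix_inv A = (1 / det A) *\<^sub>R cof A"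
proof -
  have mat_det: "mat (det A) = det A *\<^sub>R (mat 1 :: real ^ 'k ^ 'k)" by (simp add: mat_def vec_eq_iff)
  have "cof A = matrix_inv A ** A ** cof A"
    using assms by (simp add: matrix_inv_left invertible_det_nz)
  also have "\<dots> = det A *\<^sub>R matrix_inv A"
    by (simp add: matrix_mul_assoc[symmetric] cof_right mat_det matrix_scalar_ac)
  finally show ?thesis using assms by simp
qed

text \<open>Cramer's rule presents the inverse as a quotient with a nonvanishing denominator. The
  determinant condition is imposed on all of \<open>U\<close> because the quotient must represent
  the inverse in a neighbourhood of \<open>q\<close>.\<close>

lemma entries_differentiable_matrix_inv:
  fixes S :: "real ^ 'k::finite \<Rightarrow> real ^ 'n::finite ^ 'n"
  assumes "open U" "q \<in> U" "\<And>z. z \<in> U \<Longrightarrow> det (S z) \<noteq> 0" "entries_differentiable S q"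
  shows "entries_differentiable (\<lambda>z. matrix_inv (S z)) q"
  unfolding entries_differentiable_def
proof (intro allI)
  fix \<alpha> \<beta>
  have "(\<lambda>z. cof (S z) $ \<alpha> $ \<beta> / det (S z)) differentiable (at q)"
    using assms pd_det(1)[OF assms(4)] entries_differentiable_cof[OF assms(4)]
    by (intro differentiable_divide) (auto simp: entries_differentiable_def)
  then obtain F where "((\<lambda>z. cof (S z) $ \<alpha> $ \<beta> / det (S z)) has_derivative F) (at q)"
    by (auto simp: differentiable_def)
  then have "((\<lambda>z. matrix_inv (S z) $ \<alpha> $ \<beta>) has_derivative F) (at q)"
    by (rule has_derivative_transform_within_open[OF _ assms(1,2)]) (simp add: matrix_inv_eq_cof assms(3))
  then show "(\<lambda>z. matrix_inv (S z) $ \<alpha> $ \<beta>) differentiable (at q)"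
    by (auto simp: differentiable_def)
qed

text \<open>Differentiate S cof S = (det S) I, use Jacobi's formula on the right, and multiply by
  cof S from the left. The determinant stays as a factor, so that no inverse enters later
  computations.\<close>

lemma mpd_cof:
  fixes S :: "real ^ 'k::finite \<Rightarrow> real ^ 'n::finite ^ 'n"
  assumes "entries_differentiable S q" "det (S q) \<noteq> 0"
  shows "det (S q) *\<^sub>R mpd \<gamma> (\<lambda>z. cof (S z)) q
    = trace (cof (S q) ** mpd \<gamma> S q) *\<^sub>R cof (S q) - cof (S q) ** mpd \<gamma> S q ** cof (S q)"
proof -
  let ?A = "cof (S q)" and ?S' = "mpd \<gamma> S q" and ?A' = "mpd \<gamma> (\<lambda>z. cof (S z)) q"
  have mat_scale: "mat c = c *\<^sub>R (mat 1 :: real ^ 'n ^ 'n)" for c by (simp add: mat_def vec_eq_iff)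
  have "?S' ** ?A + S q ** ?A' = mpd \<gamma> (\<lambda>z. S z ** cof (S z)) q"
    by (simp add: mpd_mult assms(1) entries_differentiable_cof)
  also have "\<dots> = mpd \<gamma> (\<lambda>z. mat (det (S z))) q" by (simp add: cof_right)
  also have "\<dots> = trace (?A ** ?S') *\<^sub>R mat 1"
    by (simp add: mpd_def mat_def vec_eq_iff pd_det(2)[OF assms(1)])
  finally have "?A ** (?S' ** ?A + S q ** ?A') = ?A ** (trace (?A ** ?S') *\<^sub>R mat 1)" by simp
  then show ?thesis
    by (simp add: matrix_add_ldistrib matrix_mul_assoc cof_left[OF assms(2)] mat_scale[of "det (S q)"]
        matrix_scalar_ac scalar_matrix_assoc[symmetric] algebra_simps)
qed

lemma mpd_matrix_inv:
  fixes S :: "real ^ 'k::finite \<Rightarrow> real ^ 'n::finite ^ 'n"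
  assumes "open U" "q \<in> U" "\<And>z. z \<in> U \<Longrightarrow> det (S z) \<noteq> 0" "entries_differentiable S q"
  shows "mpd \<gamma> (\<lambda>z. matrix_inv (S z)) q = - (matrix_inv (S q) ** mpd \<gamma> S q ** matrix_inv (S q))"
proof -
  let ?H = "matrix_inv (S q)" and ?S' = "mpd \<gamma> S q" and ?H' = "mpd \<gamma> (\<lambda>z. matrix_inv (S z)) q"
  have inv: "invertible (S z)" if "z \<in> U" for z
    using assms(3)[OF that] by (simp add: invertible_det_nz)
  have "?S' ** ?H + S q ** ?H' = mpd \<gamma> (\<lambda>z. S z ** matrix_inv (S z)) q"
    by (simp add: mpd_mult assms(4) entries_differentiable_matrix_inv[OF assms])
  also have "\<dots> = mpd \<gamma> (\<lambda>z. mat 1) q"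
    by (rule mpd_cong[OF assms(1,2)]) (simp add: matrix_inv_right inv)
  also have "\<dots> = 0" by (simp add: mpd_def vec_eq_iff)
  finally have "?H ** (?S' ** ?H + S q ** ?H') = 0" by (simp add: matrix_matrix_mult_def vec_eq_iff)
  then have "?H ** ?S' ** ?H + ?H' = 0"
    by (simp add: matrix_add_ldistrib matrix_mul_assoc matrix_inv_left inv assms(2))
  then show ?thesis by (simp add: add_eq_0_iff)
qed

section \<open>Special conformal Killing tensors\<close>

lemma matrix_add_rdistrib: "(A + B) ** C = A ** C + B ** C"
  for A B :: "real ^ 'b::finite ^ 'a::finite" and C :: "real ^ 'c::finite ^ 'b"
  by (simp add: matrix_matrix_mult_def vec_eq_iff algebra_simps sum.distrib)

lemma matrix_sub_ldistrib: "A ** (B - C) = A ** B - A ** C"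
  for A :: "real ^ 'b::finite ^ 'a::finite" and B C :: "real ^ 'c::finite ^ 'b"
  by (simp add: matrix_matrix_mult_def vec_eq_iff algebra_simps sum_subtractf)

lemma matrix_sub_rdistrib: "(A - B) ** C = A ** C - B ** C"
  for A B :: "real ^ 'b::finite ^ 'a::finite" and C :: "real ^ 'c::finite ^ 'b"
  by (simp add: matrix_matrix_mult_def vec_eq_iff algebra_simps sum_subtractf)

lemmas matrix_distribs = matrix_add_ldistrib matrix_add_rdistrib matrix_sub_ldistrib matrix_sub_rdistrib
  matrix_scalar_ac scalar_matrix_assoc[symmetric] matrix_mul_assoc

lemma mat_mult_scaleR: "mat c ** A = c *\<^sub>R A" "A ** mat c = c *\<^sub>R A" for A :: "real ^ 'k::finite ^ 'k"
  by (simp_all add: matrix_matrix_mult_def mat_def vec_eq_iff if_distrib if_distribR cong: if_cong)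

text \<open>$(\Gamma^\mu_{\gamma\nu})_{\mu\nu}$ for fixed $\gamma$, and $(p_\gamma \Gamma^\gamma_{\beta\nu})_{\beta\nu}$.\<close>

definition christoffel_matrix :: "(real ^ 'k::finite \<Rightarrow> real ^ 'k ^ 'k) \<Rightarrow> 'k \<Rightarrow> real ^ 'k \<Rightarrow> real ^ 'k ^ 'k" where
  "christoffel_matrix g \<gamma> q = (\<chi> \<mu> \<nu>. christoffel g \<mu> \<gamma> \<nu> q)"

definition christoffel_form :: "(real ^ 'k::finite \<Rightarrow> real ^ 'k ^ 'k) \<Rightarrow> real ^ 'k \<Rightarrow> real ^ 'k \<Rightarrow> real ^ 'k ^ 'k" where
  "christoffel_form g p q = (\<chi> \<beta> \<nu>. \<Sum>\<gamma>\<in>UNIV. p $ \<gamma> * christoffel g \<gamma> \<beta> \<nu> q)"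

lemma christoffel_form_nth: "christoffel_form g p q $ \<beta> = p v* christoffel_matrix g \<beta> q"
  by (simp add: christoffel_form_def christoffel_matrix_def vector_matrix_mult_def vec_eq_iff mult.commute)

section \<open>The Levi-Civita connection in matrix form\<close>

locale riemannian_domain =
  fixes U :: "(real ^ 'k::finite) set" and g :: "real ^ 'k \<Rightarrow> real ^ 'k ^ 'k"
  assumes open_U: "open U" and metric: "riemannian_metric U g"
begin

lemma metric_sym: "q \<in> U \<Longrightarrow> transpose (g q) = g q"
  using metric by (simp add: riemannian_metric_def)

lemma metric_nth_sym: "q \<in> U \<Longrightarrow> g q $ \<alpha> $ \<beta> = g q $ \<beta> $ \<alpha>"
  using metric_sym[of q] by (metis transpose_def vec_lambda_beta)

lemma metric_det: "q \<in> U \<Longrightarrow> det (g q) \<noteq> 0"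
proof -
  assume q: "q \<in> U"
  have "v = 0" if "g q *v v = 0" for v
    using metric q that unfolding riemannian_metric_def by (metis inner_zero_right less_irrefl)
  then have "invertible (g q)"
    by (simp add: invertible_left_inverse matrix_left_invertible_ker)
  then show ?thesis by (simp add: invertible_det_nz)
qed

lemma metric_inv:
  assumes "q \<in> U"
  shows "matrix_inv (g q) ** g q = mat 1" "g q ** matrix_inv (g q) = mat 1"
  using assms metric_det[of q] by (simp_all add: matrix_inv_left matrix_inv_right invertible_det_nz)

lemma metric_inv_sym:
  assumes "q \<in> U"
  shows "transpose (matrix_inv (g q)) = matrix_inv (g q)"
proof -
  let ?h = "matrix_inv (g q)"
  have "transpose ?h = transpose ?h ** (g q ** ?h)" by (simp add: metric_inv assms)
  also have "\<dots> = transpose (g q ** ?h) ** ?h"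
    by (simp add: matrix_mul_assoc matrix_transpose_mul metric_sym assms)
  finally show ?thesis by (simp add: metric_inv assms)
qed

lemma metric_differentiable: "q \<in> U \<Longrightarrow> entries_differentiable g q"
  using metric by (auto simp: riemannian_metric_def smooth_tensor_def entries_differentiable_def
    intro: smooth_fn_differentiable)

lemma pd_metric_sym: "q \<in> U \<Longrightarrow> pd \<gamma> (\<lambda>z. g z $ \<alpha> $ \<beta>) q = pd \<gamma> (\<lambda>z. g z $ \<beta> $ \<alpha>) q"
  by (rule pd_cong[OF open_U]) (auto intro: metric_nth_sym)

lemma christoffel_sym: "q \<in> U \<Longrightarrow> christoffel g \<gamma> \<alpha> \<beta> q = christoffel g \<gamma> \<beta> \<alpha> q"
  unfolding christoffel_def using pd_metric_sym[of q _ \<alpha> \<beta>] by (simp add: add.commute)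

lemma christoffel_form_sym: "q \<in> U \<Longrightarrow> transpose (christoffel_form g p q) = christoffel_form g p q"
  by (simp add: christoffel_form_def transpose_def vec_eq_iff christoffel_sym)

text \<open>Lowering the index gives the Christoffel symbols of the first kind. They contain no
  inverse metric, so metric compatibility and the block structure of a product metric can be read
  off from them.\<close>

lemma metric_christoffel:
  assumes "q \<in> U"
  shows "g q ** christoffel_matrix g \<gamma> q = (\<chi> \<delta> \<nu>. (1/2) *
    (pd \<gamma> (\<lambda>z. g z $ \<delta> $ \<nu>) q + pd \<nu> (\<lambda>z. g z $ \<delta> $ \<gamma>) q - pd \<delta> (\<lambda>z. g z $ \<gamma> $ \<nu>) q))" (is "_ = ?L")
proof -
  have "christoffel_matrix g \<gamma> q = matrix_inv (g q) ** ?L"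
    by (simp add: christoffel_matrix_def christoffel_def matrix_matrix_mult_def vec_eq_iff
        sum_distrib_left algebra_simps)
  then show ?thesis by (simp add: matrix_mul_assoc metric_inv assms)
qed

text \<open>Metric compatibility of the connection: symmetrizing the symbols of the first kind
  leaves only the derivative in direction \<gamma>.\<close>

lemma mpd_metric:
  assumes "q \<in> U"
  shows "mpd \<gamma> g q = transpose (christoffel_matrix g \<gamma> q) ** g q + g q ** christoffel_matrix g \<gamma> q"
proof -
  have "transpose (christoffel_matrix g \<gamma> q) ** g q = transpose (g q ** christoffel_matrix g \<gamma> q)"
    by (simp add: matrix_transpose_mul metric_sym assms)
  moreover have "pd \<gamma> (\<lambda>z. g z $ \<alpha> $ \<beta>) q = pd \<gamma> (\<lambda>z. g z $ \<beta> $ \<alpha>) q" for \<alpha> \<beta> \<gamma>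
    by (rule pd_metric_sym[OF assms])
  ultimately show ?thesis
    by (simp add: metric_christoffel assms transpose_def vec_eq_iff mpd_def) (simp add: field_simps)
qed

lemma mpd_metric_inv:
  assumes "q \<in> U"
  shows "mpd \<gamma> (\<lambda>z. matrix_inv (g z)) q = - (matrix_inv (g q) ** transpose (christoffel_matrix g \<gamma> q))
    - christoffel_matrix g \<gamma> q ** matrix_inv (g q)"
proof -
  have "matrix_inv (g q) ** mpd \<gamma> g q ** matrix_inv (g q)
    = matrix_inv (g q) ** transpose (christoffel_matrix g \<gamma> q) ** (g q ** matrix_inv (g q))
      + (matrix_inv (g q) ** g q) ** christoffel_matrix g \<gamma> q ** matrix_inv (g q)"
    by (simp add: mpd_metric assms matrix_distribs)
  then show ?thesis
    by (simp add: mpd_matrix_inv[OF open_U assms metric_det metric_differentiable[OF assms]] metric_inv assms)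
qed

lemma cov_deriv_matrix:
  assumes "q \<in> U"
  shows "cov_deriv g S \<alpha> \<beta> \<gamma> q = (mpd \<gamma> S q - transpose (christoffel_matrix g \<gamma> q) ** S q
    - S q ** christoffel_matrix g \<gamma> q) $ \<alpha> $ \<beta>"
  by (simp add: cov_deriv_def mpd_def christoffel_matrix_def transpose_def matrix_matrix_mult_def
      christoffel_sym[OF assms, of _ \<gamma>] mult.commute)

text \<open>Since g is parallel, lowering an index commutes with covariant differentiation. The
  inner factor is the covariant derivative of the (1,1) tensor, in which the connection acts by a
  commutator.\<close>

lemma cov_deriv_metric_mult:
  assumes "q \<in> U" "entries_differentiable J q"
  shows "cov_deriv g (\<lambda>z. g z ** J z) \<alpha> \<beta> \<gamma> q
    = (g q ** (mpd \<gamma> J q + christoffel_matrix g \<gamma> q ** J q - J q ** christoffel_matrix g \<gamma> q)) $ \<alpha> $ \<beta>"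
  by (simp add: cov_deriv_matrix assms mpd_mult metric_differentiable mpd_metric matrix_distribs)

end

text \<open>$\frac12(\alpha^\mu g_{\gamma\nu} + \delta^\mu_\gamma \alpha_\nu)$, the value of $J^\mu_{\nu|\gamma}$ for a
  special conformal Killing tensor.\<close>

definition conformal_part :: "(real ^ 'k::finite \<Rightarrow> real ^ 'k ^ 'k) \<Rightarrow> real ^ 'k \<Rightarrow> 'k \<Rightarrow> real ^ 'k \<Rightarrow> real ^ 'k ^ 'k" where
  "conformal_part g \<alpha> \<gamma> q = (\<chi> \<mu> \<nu>. (1/2) * ((matrix_inv (g q) *v \<alpha>) $ \<mu> * g q $ \<gamma> $ \<nu> + axis \<gamma> 1 $ \<mu> * \<alpha> $ \<nu>))"

text \<open>The conformal part is half the sum of two rank-one matrices, so every pairing with it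
  splits into products of scalars.\<close>

lemma inner_conformal_part:
  "\<xi> \<bullet> (conformal_part g \<alpha> \<gamma> q *v w)
    = (1/2) * ((\<xi> \<bullet> (matrix_inv (g q) *v \<alpha>)) * (g q *v w) $ \<gamma> + \<xi> $ \<gamma> * (\<alpha> \<bullet> w))"
proof -
  have "conformal_part g \<alpha> \<gamma> q *v w
    = (1/2) *\<^sub>R ((g q *v w) $ \<gamma> *\<^sub>R (matrix_inv (g q) *v \<alpha>) + (\<alpha> \<bullet> w) *\<^sub>R axis \<gamma> 1)"
    by (simp add: conformal_part_def matrix_vector_mult_def[of "vec_lambda _"] vec_eq_iff matrix_vector_mult_def[of "g q" w] inner_vec_def
        sum_distrib_left sum_distrib_right sum.distrib algebra_simps)
  then show ?thesis by (simp add: inner_add_right inner_axis algebra_simps)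
qed

section \<open>Derivatives of a special conformal Killing tensor and of its cofactor\<close>

locale scKt_domain = riemannian_domain U g for U :: "(real ^ 'k::finite) set" and g +
  fixes J :: "real ^ 'k \<Rightarrow> real ^ 'k ^ 'k"
  assumes scKt: "scKt U g J"
begin

abbreviation dtr :: "real ^ 'k \<Rightarrow> real ^ 'k" where "dtr \<equiv> d0 (\<lambda>z. trace (J z))"

lemma tensor_differentiable: "q \<in> U \<Longrightarrow> entries_differentiable J q"
  using scKt by (auto simp: scKt_def smooth_tensor_def entries_differentiable_def
    intro: smooth_fn_differentiable)

lemma metric_tensor_sym: "q \<in> U \<Longrightarrow> transpose (J q) ** g q = g q ** J q"
  using scKt metric_sym[of q] unfolding scKt_def by (metis matrix_transpose_mul)

text \<open>The defining equation with its first index raised; the invertible g is cancelled from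
  both sides. The commutator is the connection term, the rest is the true covariant
  derivative.\<close>

lemma mpd_tensor:
  assumes "q \<in> U"
  shows "mpd \<gamma> J q = J q ** christoffel_matrix g \<gamma> q - christoffel_matrix g \<gamma> q ** J q
    + conformal_part g (dtr q) \<gamma> q"
proof -
  let ?G = "christoffel_matrix g \<gamma> q" and ?K = "conformal_part g (dtr q) \<gamma> q"
  have "(g q ** (mpd \<gamma> J q + ?G ** J q - J q ** ?G)) $ \<alpha> $ \<beta> = (g q ** ?K) $ \<alpha> $ \<beta>" for \<alpha> \<beta>
  proof -
    have "(g q ** (mpd \<gamma> J q + ?G ** J q - J q ** ?G)) $ \<alpha> $ \<beta>
        = (1/2) * (dtr q $ \<alpha> * g q $ \<beta> $ \<gamma> + dtr q $ \<beta> * g q $ \<alpha> $ \<gamma>)"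
      unfolding cov_deriv_metric_mult[OF assms tensor_differentiable[OF assms], symmetric]
      using scKt assms unfolding scKt_def by blast
    also have "\<dots> = (1/2) * ((g q *v (matrix_inv (g q) *v dtr q)) $ \<alpha> * g q $ \<gamma> $ \<beta> + (g q *v axis \<gamma> 1) $ \<alpha> * dtr q $ \<beta>)"
      by (simp add: matrix_vector_mul_assoc metric_inv assms metric_nth_sym[OF assms, of \<beta> \<gamma>] matrix_vector_mult_basis column_def)
    also have "\<dots> = (g q ** ?K) $ \<alpha> $ \<beta>"
      by (simp add: matrix_matrix_mult_def matrix_vector_mult_def[of "g q"] conformal_part_def
          sum_distrib_left sum_distrib_right sum.distrib algebra_simps)
    finally show ?thesis .
  qed
  then have "g q ** (mpd \<gamma> J q + ?G ** J q - J q ** ?G) = g q ** ?K" by (simp add: vec_eq_iff)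
  then have "matrix_inv (g q) ** g q ** (mpd \<gamma> J q + ?G ** J q - J q ** ?G) = matrix_inv (g q) ** g q ** ?K"
    by (simp only: matrix_mul_assoc[symmetric])
  then show ?thesis by (simp add: metric_inv assms algebra_simps)
qed

text \<open>The inverse of a g-symmetric tensor is g-symmetric. The argument inserts J cof J = (det
  J) I instead of forming the inverse.\<close>

lemma cof_metric_sym:
  assumes "q \<in> U" "det (J q) \<noteq> 0"
  shows "transpose (cof (J q)) ** g q = g q ** cof (J q)"
proof -
  let ?A = "cof (J q)" and ?D = "det (J q)"
  have "?D *\<^sub>R (transpose ?A ** g q) = transpose ?A ** g q ** (J q ** ?A)"
    by (simp add: cof_right mat_mult_scaleR)
  also have "\<dots> = transpose (J q ** ?A) ** g q ** ?A"
    by (simp add: matrix_mul_assoc matrix_transpose_mul metric_tensor_sym[symmetric] assms)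
      (simp add: matrix_mul_assoc[symmetric] metric_tensor_sym assms)
  also have "\<dots> = ?D *\<^sub>R (g q ** ?A)"
    by (simp add: cof_right mat_mult_scaleR matrix_distribs)
  finally show ?thesis using assms by simp
qed

lemma cof_metric_inv_sym:
  assumes "q \<in> U" "det (J q) \<noteq> 0"
  shows "transpose (cof (J q) ** matrix_inv (g q)) = cof (J q) ** matrix_inv (g q)"
proof -
  let ?A = "cof (J q)" and ?h = "matrix_inv (g q)"
  have "?h ** transpose ?A = ?h ** (transpose ?A ** g q) ** ?h"
    by (simp add: matrix_mul_assoc[symmetric] metric_inv assms)
  also have "\<dots> = (?h ** g q) ** ?A ** ?h" by (simp add: cof_metric_sym assms matrix_mul_assoc)
  finally show ?thesis by (simp add: metric_inv assms matrix_transpose_mul metric_inv_sym)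
qed

text \<open>In \<open>mpd_cof\<close> the commutator drops out of the trace, because J and its
  cofactor commute. The two halves of the conformal part contribute equally to that trace by
  g-symmetry of the cofactor, so the differential of det J is dtr acted on by cof J.\<close>

lemma mpd_cof_tensor:
  assumes "q \<in> U" "det (J q) \<noteq> 0"
  shows "det (J q) *\<^sub>R mpd \<gamma> (\<lambda>z. cof (J z)) q
    = det (J q) *\<^sub>R (cof (J q) ** christoffel_matrix g \<gamma> q - christoffel_matrix g \<gamma> q ** cof (J q))
      + (dtr q v* cof (J q)) $ \<gamma> *\<^sub>R cof (J q) - cof (J q) ** conformal_part g (dtr q) \<gamma> q ** cof (J q)"
proof -
  let ?A = "cof (J q)" and ?D = "det (J q)" and ?G = "christoffel_matrix g \<gamma> q"
    and ?K = "conformal_part g (dtr q) \<gamma> q" and ?h = "matrix_inv (g q)"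
  have AJ: "?A ** J q = mat ?D" and JA: "J q ** ?A = mat ?D"
    using assms by (simp_all add: cof_left cof_right)
  have AJGA: "?A ** (J q ** ?G - ?G ** J q + ?K) ** ?A = ?D *\<^sub>R (?G ** ?A) - ?D *\<^sub>R (?A ** ?G) + ?A ** ?K ** ?A"
    by (simp add: matrix_distribs AJ mat_mult_scaleR) (simp add: matrix_mul_assoc[symmetric] JA mat_mult_scaleR
        matrix_scalar_ac scalar_matrix_assoc[symmetric])
  have "trace (?A ** (?G ** J q)) = trace (J q ** ?A ** ?G)"
    by (metis matrix_mul_assoc trace_mul_sym)
  moreover have "trace (?A ** (J q ** ?G)) = trace (mat ?D ** ?G)" by (simp add: matrix_mul_assoc AJ)
  ultimately have tr: "trace (?A ** (J q ** ?G - ?G ** J q + ?K)) = trace (?A ** ?K)"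
    by (simp add: matrix_add_ldistrib matrix_sub_ldistrib trace_add trace_sub JA)
  have "trace (?A ** ?K) = (1/2) * ((g q *v (?A *v (?h *v dtr q))) $ \<gamma> + (dtr q v* ?A) $ \<gamma>)"
  proof -
    have "trace (?A ** ?K) = (\<Sum>\<mu>\<in>UNIV. (?A *v (\<chi> \<nu>. ?K $ \<nu> $ \<mu>)) $ \<mu>)"
      by (simp add: trace_def matrix_matrix_mult_def matrix_vector_mult_def)
    also have "\<dots> = (\<Sum>\<mu>\<in>UNIV. (1/2) * (g q $ \<gamma> $ \<mu> * (?A *v (?h *v dtr q)) $ \<mu> + dtr q $ \<mu> * ?A $ \<mu> $ \<gamma>))"
    proof (rule sum.cong[OF refl])
      fix \<mu>
      have "(\<chi> \<nu>. ?K $ \<nu> $ \<mu>) = (1/2) *\<^sub>R (g q $ \<gamma> $ \<mu> *\<^sub>R (?h *v dtr q) + dtr q $ \<mu> *\<^sub>R axis \<gamma> 1)"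
        by (simp add: conformal_part_def vec_eq_iff algebra_simps)
      then show "(?A *v (\<chi> \<nu>. ?K $ \<nu> $ \<mu>)) $ \<mu>
          = (1/2) * (g q $ \<gamma> $ \<mu> * (?A *v (?h *v dtr q)) $ \<mu> + dtr q $ \<mu> * ?A $ \<mu> $ \<gamma>)"
        by (simp add: matrix_vector_mult_scaleR matrix_vector_right_distrib matrix_vector_mult_basis column_def)
    qed
    also have "\<dots> = (1/2) * ((g q *v (?A *v (?h *v dtr q))) $ \<gamma> + (dtr q v* ?A) $ \<gamma>)"
      by (simp add: matrix_vector_mult_def[of "g q"] vector_matrix_mult_def sum.distrib sum_distrib_left algebra_simps)
    finally show ?thesis .
  qed
  also have "g q *v (?A *v (?h *v dtr q)) = dtr q v* ?A"
  proof -
    have "g q ** ?A ** ?h = transpose ?A"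
      unfolding cof_metric_sym[OF assms, symmetric] by (simp add: matrix_mul_assoc[symmetric] metric_inv assms)
    then show ?thesis by (simp add: matrix_vector_mul_assoc matrix_mul_assoc)
  qed
  finally have "trace (?A ** mpd \<gamma> J q) = (dtr q v* ?A) $ \<gamma>"
    by (simp add: mpd_tensor assms tr)
  then show ?thesis
    unfolding mpd_cof[OF tensor_differentiable[OF assms(1)] assms(2)]
    by (simp add: mpd_tensor assms AJGA scaleR_diff_right)
qed

end

section \<open>The operator D_J in covariant form, and closed forms\<close>

lemma axis_vector_matrix: "(axis \<gamma> 1 v* A) $ \<beta> = A $ \<gamma> $ \<beta>" for A :: "real ^ 'b::finite ^ 'k::finite"
  by (simp add: vector_matrix_mult_def axis_def if_distrib if_distribR cong: if_cong)

lemma sum_mult_axis: "(\<Sum>\<gamma>\<in>UNIV. f \<gamma> * axis \<gamma> 1 $ \<beta>) = f \<beta>" for f :: "'k::finite \<Rightarrow> real"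
  by (simp add: axis_def if_distrib cong: if_cong)

definition form_jacobian :: "(real ^ 'k::finite \<Rightarrow> real ^ 'k) \<Rightarrow> real ^ 'k \<Rightarrow> real ^ 'k ^ 'k" where
  "form_jacobian \<rho> q = (\<chi> \<gamma> \<beta>. pd \<gamma> (\<lambda>z. \<rho> z $ \<beta>) q)"

lemma D_J_nth:
  "D_J J \<rho> q $ \<alpha> $ \<beta> = (transpose (J q) ** form_jacobian \<rho> q) $ \<alpha> $ \<beta> - (transpose (J q) ** form_jacobian \<rho> q) $ \<beta> $ \<alpha>
    - ((\<rho> q v* mpd \<alpha> J q) $ \<beta> - (\<rho> q v* mpd \<beta> J q) $ \<alpha>) + wedge (d0 (\<lambda>z. trace (J z)) q) (\<rho> q) $ \<alpha> $ \<beta>"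
proof -
  have *: "(d0 (\<lambda>z. \<rho> z $ \<gamma>) q v* J q) $ \<alpha> = (transpose (J q) ** form_jacobian \<rho> q) $ \<alpha> $ \<gamma>" for \<alpha> \<gamma>
    by (simp add: form_jacobian_def vector_matrix_mult_def matrix_matrix_mult_def transpose_def d0_def mult.commute)
  have "d_J J \<rho> q $ \<alpha> $ \<beta> = (\<Sum>\<gamma>\<in>UNIV. (transpose (J q) ** form_jacobian \<rho> q) $ \<alpha> $ \<gamma> * axis \<gamma> 1 $ \<beta>
      - (transpose (J q) ** form_jacobian \<rho> q) $ \<beta> $ \<gamma> * axis \<gamma> 1 $ \<alpha>
      - \<rho> q $ \<gamma> * (mpd \<alpha> J q $ \<gamma> $ \<beta> - mpd \<beta> J q $ \<gamma> $ \<alpha>))"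
    by (simp add: d_J_def wedge_def * d1_def axis_vector_matrix mpd_def)
  also have "\<dots> = (transpose (J q) ** form_jacobian \<rho> q) $ \<alpha> $ \<beta> - (transpose (J q) ** form_jacobian \<rho> q) $ \<beta> $ \<alpha>
    - ((\<rho> q v* mpd \<alpha> J q) $ \<beta> - (\<rho> q v* mpd \<beta> J q) $ \<alpha>)"
    by (simp add: sum_subtractf sum_mult_axis right_diff_distrib) (simp add: vector_matrix_mult_def mult.commute)
  finally show ?thesis by (simp add: D_J_def)
qed

lemma wedge_vector_matrix: "transpose A ** wedge \<rho> \<sigma> ** A = wedge (\<rho> v* A) (\<sigma> v* A)"
  for A :: "real ^ 'k::finite ^ 'k"
proof -
  \<comment> \<open>Written as a difference of rank-one products, so that the congruence acts on
    each factor separately.\<close>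
  have "wedge \<rho> \<sigma> = columnvector \<rho> ** (rowvector \<sigma> :: real ^ 'k ^ 1)
      - columnvector \<sigma> ** (rowvector \<rho> :: real ^ 'k ^ 1)" for \<rho> \<sigma> :: "real ^ 'k"
    by (simp add: wedge_def columnvector_def rowvector_def matrix_matrix_mult_def vec_eq_iff mult.commute)
  moreover have "transpose A ** columnvector \<rho> = (columnvector (\<rho> v* A) :: real ^ 1 ^ 'k)" for \<rho> :: "real ^ 'k"
    by (simp add: columnvector_def matrix_matrix_mult_def vector_matrix_mult_def vec_eq_iff transpose_def mult.commute)
  moreover have "rowvector \<rho> ** A = (rowvector (\<rho> v* A) :: real ^ 'k ^ 1)" for \<rho> :: "real ^ 'k"
    by (simp add: rowvector_def matrix_matrix_mult_def vector_matrix_mult_def vec_eq_iff mult.commute)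
  ultimately show ?thesis
    by (simp add: matrix_sub_ldistrib matrix_sub_rdistrib matrix_mul_assoc)
      (simp add: matrix_mul_assoc[symmetric])
qed

lemma matrix_nth: "A $ \<alpha> $ \<beta> = (A *v axis \<beta> 1) $ \<alpha>" for A :: "real ^ 'k::finite ^ 'b::finite"
  by (simp add: matrix_vector_mult_basis column_def)

lemma vector_matrix_nth: "(\<xi> v* A) $ \<beta> = \<xi> \<bullet> (A *v axis \<beta> 1)" for A :: "real ^ 'k::finite ^ 'b::finite"
  by (simp add: dot_lmul_matrix[symmetric] inner_axis)

lemma conformal_part_vector_matrix:
  "(\<xi> v* conformal_part g \<alpha> \<gamma> q v* A) $ \<beta>
    = (1/2) * ((\<xi> \<bullet> (matrix_inv (g q) *v \<alpha>)) * (g q ** A) $ \<gamma> $ \<beta> + \<xi> $ \<gamma> * (\<alpha> v* A) $ \<beta>)"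
  unfolding vector_matrix_mul_assoc vector_matrix_nth matrix_vector_mul_assoc[symmetric] inner_conformal_part
  by (simp add: matrix_nth[of "g q ** A"] matrix_vector_mul_assoc)

lemma matrix_mult_nth: "(A ** B) $ \<gamma> $ \<beta> = (A $ \<gamma> v* B) $ \<beta>" for A B :: "real ^ 'k::finite ^ 'k"
  by (simp add: matrix_matrix_mult_def vector_matrix_mult_def mult.commute)

lemma vector_matrix_scaleR_right: "x v* (k *\<^sub>R A) = k *\<^sub>R (x v* A)" for A :: "real ^ 'k::finite ^ 'b::finite"
  by (simp add: vector_matrix_mult_def vec_eq_iff sum_distrib_left algebra_simps)

lemma symmetric_nth: "transpose A = A \<Longrightarrow> A $ \<alpha> $ \<beta> = A $ \<beta> $ \<alpha>" for A :: "real ^ 'k::finite ^ 'k"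
  by (simp add: transpose_def vec_eq_iff)

context scKt_domain
begin

text \<open>\<open>N\<close> is the covariant derivative of \<rho>. The Christoffel form of \<rho>
  is absorbed in it, while that of \<open>\<rho> q v* J q\<close> and the metric half of the
  conformal part are symmetric and vanish under antisymmetrization. The constant 3/2 is 1 from the
  trace term in \<open>D_J\<close> plus 1/2 from the other half of the conformal part.\<close>

lemma D_J_covariant:
  fixes \<rho> :: "real ^ 'k \<Rightarrow> real ^ 'k"
  defines "N \<equiv> \<lambda>q. form_jacobian \<rho> q - christoffel_form g (\<rho> q) q"
  assumes "q \<in> U"
  shows "D_J J \<rho> q = transpose (J q) ** N q - transpose (N q) ** J q + (3/2) *\<^sub>R wedge (dtr q) (\<rho> q)"
proof -
  let ?C = "christoffel_form g (\<rho> q) q" and ?M = "form_jacobian \<rho> q"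
  have T: "(transpose (J q) ** M) $ \<beta> $ \<alpha> = (transpose M ** J q) $ \<alpha> $ \<beta>" for M \<alpha> \<beta>
    by (simp add: matrix_matrix_mult_def transpose_def mult.commute)
  have "(\<rho> q v* mpd \<alpha> J q) $ \<beta> = christoffel_form g (\<rho> q v* J q) q $ \<alpha> $ \<beta> - (?C ** J q) $ \<alpha> $ \<beta>
      + (1/2) * ((\<rho> q \<bullet> (matrix_inv (g q) *v dtr q)) * g q $ \<alpha> $ \<beta> + \<rho> q $ \<alpha> * dtr q $ \<beta>)" for \<alpha> \<beta>
    using conformal_part_vector_matrix[of "\<rho> q" g "dtr q" \<alpha> q "mat 1" \<beta>]
    by (simp add: mpd_tensor assms vector_matrix_mult_add_rdistrib vector_matrix_mult_diff_rdistrib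
        vector_matrix_mul_assoc[symmetric] christoffel_form_nth[symmetric] matrix_mult_nth)
  note K = this
  have S: "christoffel_form g (\<rho> q v* J q) q $ \<alpha> $ \<beta> = christoffel_form g (\<rho> q v* J q) q $ \<beta> $ \<alpha>" for \<alpha> \<beta>
    by (rule symmetric_nth) (simp add: christoffel_form_sym assms)
  have N: "(transpose (J q) ** N q) $ \<alpha> $ \<beta> = (transpose (J q) ** ?M) $ \<alpha> $ \<beta> - (?C ** J q) $ \<beta> $ \<alpha>"
    "(transpose (N q) ** J q) $ \<alpha> $ \<beta> = (transpose (J q) ** ?M) $ \<beta> $ \<alpha> - (?C ** J q) $ \<alpha> $ \<beta>" for \<alpha> \<beta>
    using T[of ?C \<beta> \<alpha>] T[of ?C \<alpha> \<beta>]
    by (simp_all add: T[symmetric] N_def matrix_sub_ldistrib christoffel_form_sym assms(2))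
  have "D_J J \<rho> q $ \<alpha> $ \<beta> = (transpose (J q) ** N q - transpose (N q) ** J q + (3/2) *\<^sub>R wedge (dtr q) (\<rho> q)) $ \<alpha> $ \<beta>"
    for \<alpha> \<beta>
    unfolding D_J_nth K S[of \<alpha> \<beta>] metric_nth_sym[OF assms(2), of \<alpha> \<beta>]
    by (simp add: N wedge_def) (simp add: field_simps)
  then show ?thesis by (simp add: vec_eq_iff)
qed

text \<open>With A = cof J, the exterior derivative of the form \<rho> A, multiplied by det J, is
  the congruence of D_J \<rho> by A. Both sides carry the same wedge term: on the left the 3/2 is 1
  from differentiating the determinant and 1/2 from the conformal part, on the right it is the
  constant of \<open>D_J_covariant\<close>.\<close>

lemma cof_form_closed:
  fixes \<rho> :: "real ^ 'k \<Rightarrow> real ^ 'k"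
  assumes q: "q \<in> U" "det (J q) \<noteq> 0" and D: "D_J J \<rho> q = 0"
    and \<rho>: "\<And>\<alpha>. (\<lambda>z. \<rho> z $ \<alpha>) differentiable (at q)"
  shows "d1 (\<lambda>z. \<rho> z v* cof (J z)) q = 0"
proof -
  let ?A = "cof (J q)" and ?D = "det (J q)" and ?C = "christoffel_form g (\<rho> q) q" and ?M = "form_jacobian \<rho> q"
    and ?\<sigma> = "\<rho> q v* cof (J q)"
  let ?N = "?M - ?C" and ?R = "form_jacobian (\<lambda>z. \<rho> z v* cof (J z)) q"
  have cof_diff: "(\<lambda>z. cof (J z) $ \<alpha> $ \<beta>) differentiable (at q)" for \<alpha> \<beta>
    using entries_differentiable_cof[OF tensor_differentiable[OF q(1)]] by (simp add: entries_differentiable_def)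
  have R: "?R $ \<gamma> $ \<beta> = (?M ** ?A) $ \<gamma> $ \<beta> + (\<rho> q v* mpd \<gamma> (\<lambda>z. cof (J z)) q) $ \<beta>" for \<gamma> \<beta>
    by (simp add: form_jacobian_def vector_matrix_mult_def pd_sum pd_mult cof_diff \<rho> differentiable_mult
        matrix_matrix_mult_def mpd_def sum.distrib algebra_simps)
  have DR: "?D * ?R $ \<gamma> $ \<beta> = ?D * (?N ** ?A) $ \<gamma> $ \<beta> + ?D * christoffel_form g ?\<sigma> q $ \<gamma> $ \<beta>
      + (dtr q v* ?A) $ \<gamma> * ?\<sigma> $ \<beta>
      - (1/2) * ((?\<sigma> \<bullet> (matrix_inv (g q) *v dtr q)) * (g q ** ?A) $ \<gamma> $ \<beta> + ?\<sigma> $ \<gamma> * (dtr q v* ?A) $ \<beta>)" for \<gamma> \<beta>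
  proof -
    have "?D * (\<rho> q v* mpd \<gamma> (\<lambda>z. cof (J z)) q) $ \<beta> = (\<rho> q v* (?D *\<^sub>R mpd \<gamma> (\<lambda>z. cof (J z)) q)) $ \<beta>"
      by (simp add: vector_matrix_scaleR_right)
    also have "\<dots> = ?D * christoffel_form g ?\<sigma> q $ \<gamma> $ \<beta> - ?D * (?C ** ?A) $ \<gamma> $ \<beta>
      + (dtr q v* ?A) $ \<gamma> * ?\<sigma> $ \<beta> - (?\<sigma> v* conformal_part g (dtr q) \<gamma> q v* ?A) $ \<beta>"
      unfolding mpd_cof_tensor[OF q]
      by (simp add: vector_matrix_mult_add_rdistrib vector_matrix_mult_diff_rdistrib
        vector_matrix_mul_assoc[symmetric] christoffel_form_nth matrix_mult_nth vector_matrix_scaleR_right algebra_simps)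
    finally show ?thesis
      by (simp add: R distrib_left conformal_part_vector_matrix matrix_sub_rdistrib algebra_simps)
  qed
  have gA: "(g q ** ?A) $ \<gamma> $ \<beta> = (g q ** ?A) $ \<beta> $ \<gamma>" for \<gamma> \<beta>
  proof -
    have "transpose (g q ** ?A) = g q ** ?A"
      by (simp add: matrix_transpose_mul metric_sym q cof_metric_sym)
    then show ?thesis by (rule symmetric_nth)
  qed
  have Csym: "christoffel_form g ?\<sigma> q $ \<gamma> $ \<beta> = christoffel_form g ?\<sigma> q $ \<beta> $ \<gamma>" for \<gamma> \<beta>
    by (rule symmetric_nth) (simp add: christoffel_form_sym q)
  have "0 = transpose ?A ** D_J J \<rho> q ** ?A" by (simp add: D matrix_matrix_mult_def vec_eq_iff)
  also have "\<dots> = transpose (J q ** ?A) ** ?N ** ?A - transpose ?A ** transpose ?N ** (J q ** ?A)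
      + (3/2) *\<^sub>R wedge (dtr q v* ?A) ?\<sigma>"
    by (simp add: D_J_covariant q matrix_distribs wedge_vector_matrix[symmetric] matrix_transpose_mul)
  also have "\<dots> = ?D *\<^sub>R (?N ** ?A - transpose (?N ** ?A)) + (3/2) *\<^sub>R wedge (dtr q v* ?A) ?\<sigma>"
    by (simp add: cof_right mat_mult_scaleR scalar_matrix_assoc[symmetric] matrix_scalar_ac matrix_transpose_mul
        scaleR_diff_right[of _ "?N ** ?A"])
  finally have "0 = (?D *\<^sub>R (?N ** ?A - transpose (?N ** ?A)) + (3/2) *\<^sub>R wedge (dtr q v* ?A) ?\<sigma>) $ \<gamma> $ \<beta>" for \<gamma> \<beta>
    by (metis zero_index)
  then have "?D * (?N ** ?A) $ \<gamma> $ \<beta> - ?D * (?N ** ?A) $ \<beta> $ \<gamma>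
      + (3/2) * ((dtr q v* ?A) $ \<gamma> * ?\<sigma> $ \<beta> - (dtr q v* ?A) $ \<beta> * ?\<sigma> $ \<gamma>) = 0" for \<gamma> \<beta>
    by (simp add: transpose_def wedge_def right_diff_distrib)
  then have "?D * (?R $ \<gamma> $ \<beta> - ?R $ \<beta> $ \<gamma>) = 0" for \<gamma> \<beta>
    unfolding right_diff_distrib DR gA[of \<gamma> \<beta>] Csym[of \<gamma> \<beta>] by (simp add: algebra_simps)
  then show ?thesis using q(2) by (simp add: d1_def form_jacobian_def vec_eq_iff)
qed

end

lemma uminus_matrix_vector_mult: "(- A) *v x = - (A *v x)"
  and matrix_vector_mult_uminus: "A *v (- x) = - (A *v x)" for A :: "real ^ 'k::finite ^ 'b::finite"
  by (simp_all add: matrix_vector_mult_def vec_eq_iff sum_negf)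

lemma entries_differentiable_mult:
  assumes "entries_differentiable S q" "entries_differentiable T q"
  shows "entries_differentiable (\<lambda>z. S z ** T z) q"
  using assms unfolding entries_differentiable_def matrix_matrix_mult_def
  by (auto intro!: differentiable_sum differentiable_mult)

section \<open>Quadratic functions and brackets\<close>

text \<open>The coefficient matrix is arbitrary, so that the functions \<open>H_fn\<close> and their
  generating function in the parameter are instances of the same notion.\<close>

definition quadratic :: "(real ^ 'k::finite \<Rightarrow> real ^ 'k ^ 'k) \<Rightarrow> (real ^ 'k \<Rightarrow> real) \<Rightarrow>
    (real ^ 'k) \<times> (real ^ 'k) \<Rightarrow> real" where
  "quadratic S W = (\<lambda>(q, p). (1/2) * (\<Sum>\<alpha>\<in>UNIV. \<Sum>\<beta>\<in>UNIV. S q $ \<alpha> $ \<beta> * p $ \<alpha> * p $ \<beta>) + W q)"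

lemma H_fn_quadratic: "H_fn g J i W = quadratic (\<lambda>q. A_coef i (J q) ** matrix_inv (g q)) W"
  by (simp add: H_fn_def quadratic_def)

lemma quadratic_inner: "quadratic S W (q, p) = (1/2) * (p \<bullet> (S q *v p)) + W q"
  by (simp add: quadratic_def inner_vec_def matrix_vector_mult_def sum_distrib_left mult_ac)

definition dqv :: "((real ^ 'k::finite) \<times> (real ^ 'k) \<Rightarrow> real) \<Rightarrow> (real ^ 'k) \<times> (real ^ 'k) \<Rightarrow> real ^ 'k" where
  "dqv F z = (\<chi> \<alpha>. dq \<alpha> F z)"

definition dpv :: "((real ^ 'k::finite) \<times> (real ^ 'k) \<Rightarrow> real) \<Rightarrow> (real ^ 'k) \<times> (real ^ 'k) \<Rightarrow> real ^ 'k" where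
  "dpv F z = (\<chi> \<alpha>. dp \<alpha> F z)"

text \<open>The derivatives of \<open>F\<close> along the horizontal lifts
  $\partial_{q^\alpha} + p_\gamma \Gamma^\gamma_{\alpha\beta} \partial_{p_\beta}$.\<close>

definition horizontal :: "(real ^ 'k::finite \<Rightarrow> real ^ 'k ^ 'k) \<Rightarrow> ((real ^ 'k) \<times> (real ^ 'k) \<Rightarrow> real) \<Rightarrow>
    (real ^ 'k) \<times> (real ^ 'k) \<Rightarrow> real ^ 'k" where
  "horizontal g F z = dqv F z + christoffel_form g (snd z) (fst z) *v dpv F z"

text \<open>\<open>dq\<close> and \<open>dp\<close> vary only one group of variables at a time, so
  this much differentiability already makes them linear on finite sums.\<close>

definition separately_differentiable :: "((real ^ 'k::finite) \<times> (real ^ 'k) \<Rightarrow> real) \<Rightarrow>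
    (real ^ 'k) \<times> (real ^ 'k) \<Rightarrow> bool" where
  "separately_differentiable F z \<longleftrightarrow>
    (\<lambda>q. F (q, snd z)) differentiable (at (fst z)) \<and> (\<lambda>p. F (fst z, p)) differentiable (at (snd z))"

lemma quadratic_has_derivative_p:
  assumes "transpose (S q) = S q"
  shows "((\<lambda>p. quadratic S W (q, p)) has_derivative (\<lambda>v. v \<bullet> (S q *v p))) (at p)"
proof -
  have sym: "p \<bullet> (S q *v v) = v \<bullet> (S q *v p)" for v
    by (metis assms dot_lmul_matrix inner_commute transpose_matrix_vector)
  have S: "((\<lambda>p. S q *v p) has_derivative (\<lambda>v. S q *v v)) (at p)"
    by (intro bounded_linear_imp_has_derivative matrix_vector_mul_bounded_linear)
  have "((\<lambda>p. (1/2) * (p \<bullet> (S q *v p)) + W q) has_derivative (\<lambda>v. (1/2) * (p \<bullet> (S q *v v) + v \<bullet> (S q *v p)) + 0)) (at p)"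
    by (intro has_derivative_add has_derivative_mult_right has_derivative_inner S has_derivative_ident has_derivative_const)
  then show ?thesis by (simp add: quadratic_inner sym)
qed

lemma dpv_quadratic:
  assumes "transpose (S q) = S q"
  shows "dpv (quadratic S W) (q, p) = S q *v p"
  using pd_eqI[OF quadratic_has_derivative_p[of S q, OF assms]]
  by (simp add: dpv_def dp_def vec_eq_iff inner_axis')

lemma quadratic_differentiable_q:
  assumes "entries_differentiable S q" "W differentiable (at q)"
  shows "(\<lambda>q. quadratic S W (q, p)) differentiable (at q)"
  using assms unfolding quadratic_def entries_differentiable_def prod.case
  by (intro differentiable_add differentiable_mult differentiable_const differentiable_sum ballI finite) auto

lemma dq_quadratic:
  assumes "entries_differentiable S q" "W differentiable (at q)"
  shows "dq \<gamma> (quadratic S W) (q, p) = (1/2) * (p \<bullet> (mpd \<gamma> S q *v p)) + pd \<gamma> W q"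
proof -
  have S: "(\<lambda>z. S z $ \<alpha> $ \<beta>) differentiable (at q)" for \<alpha> \<beta>
    using assms(1) by (simp add: entries_differentiable_def)
  have 1: "(\<lambda>z. S z $ \<alpha> $ \<beta> * p $ \<alpha> * p $ \<beta>) differentiable (at q)" for \<alpha> \<beta>
    by (intro differentiable_mult S differentiable_const)
  have 2: "(\<lambda>z. \<Sum>\<beta>\<in>UNIV. S z $ \<alpha> $ \<beta> * p $ \<alpha> * p $ \<beta>) differentiable (at q)" for \<alpha>
    by (intro differentiable_sum finite ballI 1)
  have 3: "(\<lambda>z. \<Sum>\<alpha>\<in>UNIV. \<Sum>\<beta>\<in>UNIV. S z $ \<alpha> $ \<beta> * p $ \<alpha> * p $ \<beta>) differentiable (at q)"
    by (intro differentiable_sum finite ballI 2)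
  have "pd \<gamma> (\<lambda>z. S z $ \<alpha> $ \<beta> * p $ \<alpha> * p $ \<beta>) q = mpd \<gamma> S q $ \<alpha> $ \<beta> * p $ \<alpha> * p $ \<beta>" for \<alpha> \<beta>
    using pd_cmult[OF S, of \<gamma> "p $ \<alpha> * p $ \<beta>" \<alpha> \<beta>] by (simp add: mpd_def mult_ac)
  then have "pd \<gamma> (\<lambda>z. \<Sum>\<alpha>\<in>UNIV. \<Sum>\<beta>\<in>UNIV. S z $ \<alpha> $ \<beta> * p $ \<alpha> * p $ \<beta>) q
      = (\<Sum>\<alpha>\<in>UNIV. \<Sum>\<beta>\<in>UNIV. mpd \<gamma> S q $ \<alpha> $ \<beta> * p $ \<alpha> * p $ \<beta>)"
    by (simp only: pd_sum[OF 2] pd_sum[OF 1])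
  then have "dq \<gamma> (quadratic S W) (q, p) = quadratic (mpd \<gamma> S) (pd \<gamma> W) (q, p)"
    using pd_add[OF differentiable_mult[OF differentiable_const 3, of "1/2"] assms(2), of \<gamma>] pd_cmult[OF 3, of \<gamma> "1/2"]
    by (simp add: dq_def quadratic_def)
  then show ?thesis by (simp add: quadratic_inner)
qed

lemma separately_differentiable_quadratic:
  assumes "entries_differentiable S q" "W differentiable (at q)"
  shows "separately_differentiable (quadratic S W) (q, p)"
proof -
  have "(\<lambda>p. quadratic S W (q, p)) differentiable (at p)"
    unfolding quadratic_def prod.case
    by (intro differentiable_add differentiable_mult differentiable_const differentiable_sum ballI finite differentiable_nth)
  then show ?thesis
    using quadratic_differentiable_q[OF assms] by (simp add: separately_differentiable_def)
qed

lemma dqv_dpv_sum: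
  assumes "\<And>i. i \<in> I \<Longrightarrow> separately_differentiable (F i) z"
  shows "dqv (\<lambda>z. \<Sum>i\<in>I. c i * F i z) z = (\<Sum>i\<in>I. c i *\<^sub>R dqv (F i) z)"
    and "dpv (\<lambda>z. \<Sum>i\<in>I. c i * F i z) z = (\<Sum>i\<in>I. c i *\<^sub>R dpv (F i) z)"
  using assms
  by (simp_all add: separately_differentiable_def dqv_def dpv_def dq_def dp_def vec_eq_iff pd_sum pd_cmult
      differentiable_mult)

section \<open>Dynamics and brackets through horizontal derivatives\<close>

context riemannian_domain
begin

lemma matrix_vector_mult_sum_scaleR: "A *v (\<Sum>i\<in>I. c i *\<^sub>R x i) = (\<Sum>i\<in>I. c i *\<^sub>R (A *v x i))"
  for A :: "real ^ 'a::finite ^ 'b::finite"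
  by (simp add: linear_sum[OF matrix_vector_mul_linear] matrix_vector_mult_scaleR)

lemma horizontal_sum:
  assumes "\<And>i. i \<in> I \<Longrightarrow> separately_differentiable (F i) z"
  shows "horizontal g (\<lambda>z. \<Sum>i\<in>I. c i * F i z) z = (\<Sum>i\<in>I. c i *\<^sub>R horizontal g (F i) z)"
  by (simp add: horizontal_def dqv_dpv_sum[OF assms] matrix_vector_mult_sum_scaleR sum.distrib scaleR_add_right)

lemma christoffel_form_apply: "(christoffel_form g p q *v w) $ \<gamma> = p \<bullet> (christoffel_matrix g \<gamma> q *v w)"
  unfolding matrix_vector_mul_component christoffel_form_nth dot_lmul_matrix ..

text \<open>The force terms quadratic in p are exactly those of the horizontal lift of u, the
  velocity obtained from p by raising the index. What is left of the vector field is the vertical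
  lift of \<mu>.\<close>

lemma Gamma_hat_horizontal:
  assumes "q \<in> U"
  shows "Gamma_hat g \<mu> F (q, p) = (matrix_inv (g q) *v p) \<bullet> horizontal g F (q, p) + \<mu> q \<bullet> dpv F (q, p)"
proof -
  let ?u = "matrix_inv (g q) *v p" and ?C = "christoffel_form g p q"
  have "(\<Sum>\<gamma>\<in>UNIV. \<Sum>\<nu>\<in>UNIV. \<Sum>\<delta>\<in>UNIV. christoffel g \<gamma> \<nu> \<alpha> q * matrix_inv (g q) $ \<nu> $ \<delta> * p $ \<gamma> * p $ \<delta>)
      = (?C *v ?u) $ \<alpha>" for \<alpha>
  proof -
    have "(?C *v ?u) $ \<alpha> = (\<Sum>\<nu>\<in>UNIV. \<Sum>\<delta>\<in>UNIV. \<Sum>\<gamma>\<in>UNIV. christoffel g \<gamma> \<nu> \<alpha> q * matrix_inv (g q) $ \<nu> $ \<delta> * p $ \<gamma> * p $ \<delta>)"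
      by (simp add: christoffel_form_def matrix_vector_mult_def sum_distrib_left sum_distrib_right
          christoffel_sym[OF assms, of _ \<alpha>] mult_ac)
    also have "\<dots> = (\<Sum>\<nu>\<in>UNIV. \<Sum>\<gamma>\<in>UNIV. \<Sum>\<delta>\<in>UNIV. christoffel g \<gamma> \<nu> \<alpha> q * matrix_inv (g q) $ \<nu> $ \<delta> * p $ \<gamma> * p $ \<delta>)"
      by (rule sum.cong[OF refl], rule sum.swap)
    finally show ?thesis by (subst sum.swap) simp
  qed
  then have "Gamma_hat g \<mu> F (q, p) = ?u \<bullet> dqv F (q, p) + (?C *v ?u + \<mu> q) \<bullet> dpv F (q, p)"
    by (simp add: Gamma_hat_def inner_vec_def dqv_def dpv_def matrix_vector_mult_def[of "matrix_inv (g q)" p])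
  moreover have "(?C *v ?u) \<bullet> dpv F (q, p) = ?u \<bullet> (?C *v dpv F (q, p))"
    using christoffel_form_sym[OF assms, of p] by (metis dot_lmul_matrix transpose_matrix_vector)
  ultimately show ?thesis by (simp add: horizontal_def inner_add_left inner_add_right)
qed

lemma Gamma_hat_sum:
  assumes "q \<in> U" "\<And>i. i \<in> I \<Longrightarrow> separately_differentiable (F i) (q, p)"
  shows "Gamma_hat g \<mu> (\<lambda>z. \<Sum>i\<in>I. c i * F i z) (q, p) = (\<Sum>i\<in>I. c i * Gamma_hat g \<mu> (F i) (q, p))"
  by (simp add: Gamma_hat_horizontal assms horizontal_sum dqv_dpv_sum inner_sum_right sum.distrib distrib_left)

end

context scKt_domain
begin

text \<open>Substituting \<open>mpd_tensor\<close> into the p-linear part of the Poisson tensor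
  produces the Christoffel terms that turn \<open>dqv\<close> into \<open>horizontal\<close>. The
  remaining Christoffel form and the metric half of the conformal part are symmetric in the two
  fibre derivatives and cancel; the half with dtr and p survives.\<close>

lemma bracket_horizontal:
  assumes "q \<in> U"
  shows "bracket J F G (q, p) = horizontal g G (q, p) \<bullet> (J q *v dpv F (q, p)) - horizontal g F (q, p) \<bullet> (J q *v dpv G (q, p))
    - (1/2) * ((dtr q \<bullet> dpv F (q, p)) * (p \<bullet> dpv G (q, p)) - (dtr q \<bullet> dpv G (q, p)) * (p \<bullet> dpv F (q, p)))"
proof -
  define X where "X v w = (\<Sum>\<beta>\<in>UNIV. w $ \<beta> * (p \<bullet> (mpd \<beta> J q *v v)))" for v w :: "real ^ 'k"
  let ?C = "\<lambda>p. christoffel_form g p q"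
  let ?F = "dpv F (q, p)" and ?G = "dpv G (q, p)"
  have X_sum: "X v w = (\<Sum>\<alpha>\<in>UNIV. \<Sum>\<beta>\<in>UNIV. \<Sum>\<gamma>\<in>UNIV. p $ \<gamma> * pd \<beta> (\<lambda>z. J z $ \<gamma> $ \<alpha>) q * (v $ \<alpha> * w $ \<beta>))" for v w
  proof -
    have "X v w = (\<Sum>\<beta>\<in>UNIV. \<Sum>\<gamma>\<in>UNIV. \<Sum>\<alpha>\<in>UNIV. p $ \<gamma> * pd \<beta> (\<lambda>z. J z $ \<gamma> $ \<alpha>) q * (v $ \<alpha> * w $ \<beta>))"
      by (simp add: X_def inner_vec_def matrix_vector_mult_def mpd_def sum_distrib_left mult_ac)
    also have "\<dots> = (\<Sum>\<beta>\<in>UNIV. \<Sum>\<alpha>\<in>UNIV. \<Sum>\<gamma>\<in>UNIV. p $ \<gamma> * pd \<beta> (\<lambda>z. J z $ \<gamma> $ \<alpha>) q * (v $ \<alpha> * w $ \<beta>))"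
      by (rule sum.cong[OF refl], rule sum.swap)
    also have "\<dots> = (\<Sum>\<alpha>\<in>UNIV. \<Sum>\<beta>\<in>UNIV. \<Sum>\<gamma>\<in>UNIV. p $ \<gamma> * pd \<beta> (\<lambda>z. J z $ \<gamma> $ \<alpha>) q * (v $ \<alpha> * w $ \<beta>))"
      by (rule sum.swap)
    finally show ?thesis .
  qed
  have X_swap: "X v w = (\<Sum>\<alpha>\<in>UNIV. \<Sum>\<beta>\<in>UNIV. \<Sum>\<gamma>\<in>UNIV. p $ \<gamma> * pd \<alpha> (\<lambda>z. J z $ \<gamma> $ \<beta>) q * (v $ \<beta> * w $ \<alpha>))" for v w
    by (subst sum.swap) (rule X_sum)
  \<comment> \<open>Naming the summand allows both index orders to be matched with
    \<open>X_sum\<close> and \<open>X_swap\<close>. Each sign occurs twice, which gives the factor 2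
    that cancels the 1/2 in \<open>bracket\<close>.\<close>
  define T where "T v w \<alpha> \<beta> \<gamma> = p $ \<gamma> * pd \<beta> (\<lambda>z. J z $ \<gamma> $ \<alpha>) q * (v $ \<alpha> * w $ \<beta>)"
    for v w :: "real ^ 'k" and \<alpha> \<beta> \<gamma>
  have torsion: "(\<Sum>\<alpha>\<in>UNIV. \<Sum>\<beta>\<in>UNIV. \<Sum>\<gamma>\<in>UNIV. p $ \<gamma> * (pd \<beta> (\<lambda>z. J z $ \<gamma> $ \<alpha>) q - pd \<alpha> (\<lambda>z. J z $ \<gamma> $ \<beta>) q) *
      bivec (dp \<alpha>) (dp \<beta>) F G (q, p)) = 2 * (X ?F ?G - X ?G ?F)"
  proof -
    have "p $ \<gamma> * (pd \<beta> (\<lambda>z. J z $ \<gamma> $ \<alpha>) q - pd \<alpha> (\<lambda>z. J z $ \<gamma> $ \<beta>) q) * bivec (dp \<alpha>) (dp \<beta>) F G (q, p)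
        = T ?F ?G \<alpha> \<beta> \<gamma> - T ?G ?F \<alpha> \<beta> \<gamma> - T ?G ?F \<beta> \<alpha> \<gamma> + T ?F ?G \<beta> \<alpha> \<gamma>" for \<alpha> \<beta> \<gamma>
      by (simp add: T_def bivec_def dpv_def algebra_simps)
    moreover have "X v w = (\<Sum>\<alpha>\<in>UNIV. \<Sum>\<beta>\<in>UNIV. \<Sum>\<gamma>\<in>UNIV. T v w \<alpha> \<beta> \<gamma>)"
      "X v w = (\<Sum>\<alpha>\<in>UNIV. \<Sum>\<beta>\<in>UNIV. \<Sum>\<gamma>\<in>UNIV. T v w \<beta> \<alpha> \<gamma>)" for v w
      unfolding T_def by (rule X_sum, rule X_swap)
    ultimately show ?thesis by (simp only: sum.distrib sum_subtractf) simp
  qed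
  have "(\<Sum>\<alpha>\<in>UNIV. \<Sum>\<beta>\<in>UNIV. J q $ \<alpha> $ \<beta> * bivec (dp \<beta>) (dq \<alpha>) F G (q, p))
      = dqv G (q, p) \<bullet> (J q *v ?F) - dqv F (q, p) \<bullet> (J q *v ?G)"
    by (simp add: bivec_def inner_vec_def matrix_vector_mult_def dqv_def dpv_def sum_distrib_left
        sum_subtractf[symmetric] algebra_simps)
  then have br: "bracket J F G (q, p) = dqv G (q, p) \<bullet> (J q *v ?F) - dqv F (q, p) \<bullet> (J q *v ?G) - (X ?F ?G - X ?G ?F)"
    unfolding bracket_def prod.case torsion by (simp add: field_simps)
  have X_eq: "X v w = w \<bullet> (?C (p v* J q) *v v) - w \<bullet> (?C p *v (J q *v v))
      + (1/2) * ((p \<bullet> (matrix_inv (g q) *v dtr q)) * (w \<bullet> (g q *v v)) + (w \<bullet> p) * (dtr q \<bullet> v))" for v w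
  proof -
    have "p \<bullet> (mpd \<beta> J q *v v) = (?C (p v* J q) *v v) $ \<beta> - (?C p *v (J q *v v)) $ \<beta>
        + (1/2) * ((p \<bullet> (matrix_inv (g q) *v dtr q)) * (g q *v v) $ \<beta> + p $ \<beta> * (dtr q \<bullet> v))" for \<beta>
      by (simp add: mpd_tensor assms matrix_vector_mult_add_rdistrib matrix_vector_mult_diff_rdistrib
          inner_add_right inner_diff_right inner_conformal_part christoffel_form_apply dot_lmul_matrix
          matrix_vector_mul_assoc[symmetric])
    then have "X v w = (\<Sum>\<beta>\<in>UNIV. w $ \<beta> * ((?C (p v* J q) *v v) $ \<beta> - (?C p *v (J q *v v)) $ \<beta>
        + (1/2) * ((p \<bullet> (matrix_inv (g q) *v dtr q)) * (g q *v v) $ \<beta> + p $ \<beta> * (dtr q \<bullet> v))))"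
      by (simp add: X_def)
    then show ?thesis
      by (simp add: inner_vec_def[of w] sum.distrib sum_subtractf sum_distrib_left sum_distrib_right algebra_simps)
  qed
  have sym: "w \<bullet> (S *v v) = v \<bullet> (S *v w)" if "transpose S = S" for S :: "real ^ 'k ^ 'k" and v w
    by (metis that dot_lmul_matrix inner_commute transpose_matrix_vector)
  have "?G \<bullet> (?C p *v (J q *v ?F)) = (?C p *v ?G) \<bullet> (J q *v ?F)" "?F \<bullet> (?C p *v (J q *v ?G)) = (?C p *v ?F) \<bullet> (J q *v ?G)"
    using sym[OF christoffel_form_sym[OF assms]] by (simp_all add: inner_commute)
  then show ?thesis
    unfolding br X_eq horizontal_def
    using sym[OF christoffel_form_sym[OF assms], of ?G "p v* J q" ?F] sym[OF metric_sym[OF assms], of ?G ?F]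
    by (simp add: inner_add_left inner_commute algebra_simps)
qed

lemma bracket_sum_left:
  assumes "q \<in> U" "\<And>i. i \<in> I \<Longrightarrow> separately_differentiable (F i) (q, p)"
  shows "bracket J (\<lambda>z. \<Sum>i\<in>I. c i * F i z) G (q, p) = (\<Sum>i\<in>I. c i * bracket J (F i) G (q, p))"
  by (simp add: bracket_horizontal assms horizontal_sum dqv_dpv_sum inner_sum_left inner_sum_right
      matrix_vector_mult_sum_scaleR sum_subtractf sum_distrib_left sum_distrib_right sum_divide_distrib
      right_diff_distrib diff_divide_distrib mult_ac)

lemma bracket_antisym: "q \<in> U \<Longrightarrow> bracket J F G (q, p) = - bracket J G F (q, p)"
  by (simp add: bracket_horizontal field_simps)

lemma bracket_sum_right:
  assumes "q \<in> U" "\<And>i. i \<in> I \<Longrightarrow> separately_differentiable (F i) (q, p)"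
  shows "bracket J G (\<lambda>z. \<Sum>i\<in>I. c i * F i z) (q, p) = (\<Sum>i\<in>I. c i * bracket J G (F i) (q, p))"
  unfolding bracket_antisym[OF assms(1), of G] by (simp add: bracket_sum_left assms sum_negf)

text \<open>The connection terms come from the cofactor (a commutator), from the inverse metric and
  from the horizontal lift, and their sum is zero. There remain the derivative of the determinant,
  the conformal part and the potential.\<close>

lemma horizontal_cof:
  assumes q: "q \<in> U" "det (J q) \<noteq> 0"
    and W: "W differentiable (at q)" "d0 W q = - (\<mu> q v* cof (J q))"
  defines "H \<equiv> quadratic (\<lambda>z. cof (J z) ** matrix_inv (g z)) W"
    and "u \<equiv> \<lambda>p. matrix_inv (g q) *v p"
  shows "dpv H (q, p) = cof (J q) *v u p"
    and "(2 * det (J q)) *\<^sub>R horizontal g H (q, p) = (p \<bullet> (cof (J q) *v u p)) *\<^sub>R (dtr q v* cof (J q))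
      - (dtr q \<bullet> (cof (J q) *v u p)) *\<^sub>R (p v* cof (J q)) - (2 * det (J q)) *\<^sub>R (\<mu> q v* cof (J q))"
proof -
  let ?A = "cof (J q)" and ?D = "det (J q)" and ?h = "matrix_inv (g q)" and ?G = "\<lambda>\<gamma>. christoffel_matrix g \<gamma> q"
  have dA: "entries_differentiable (\<lambda>z. cof (J z)) q"
    by (rule entries_differentiable_cof[OF tensor_differentiable[OF q(1)]])
  have dh: "entries_differentiable (\<lambda>z. matrix_inv (g z)) q"
    by (rule entries_differentiable_matrix_inv[OF open_U q(1) metric_det metric_differentiable[OF q(1)]])
  show dpv: "dpv H (q, p) = ?A *v u p"
    unfolding H_def using dpv_quadratic[of "\<lambda>z. cof (J z) ** matrix_inv (g z)" q] cof_metric_inv_sym[OF q]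
    by (simp add: u_def matrix_vector_mul_assoc)
  have pAh: "p \<bullet> (?A *v (?h *v w)) = (?A *v u p) \<bullet> w" for w
    using cof_metric_inv_sym[OF q] unfolding u_def matrix_vector_mul_assoc
    by (metis dot_lmul_matrix transpose_matrix_vector)
  have gA: "g q *v (?A *v u p) = p v* ?A"
  proof -
    have "g q ** ?A ** ?h = transpose ?A"
      unfolding cof_metric_sym[OF q, symmetric] by (simp add: matrix_mul_assoc[symmetric] metric_inv q)
    then show ?thesis by (simp add: u_def matrix_vector_mul_assoc matrix_mul_assoc)
  qed
  have "((2 * ?D) *\<^sub>R horizontal g H (q, p)) $ \<gamma> = ((p \<bullet> (?A *v u p)) *\<^sub>R (dtr q v* ?A)
      - (dtr q \<bullet> (?A *v u p)) *\<^sub>R (p v* ?A) - (2 * ?D) *\<^sub>R (\<mu> q v* ?A)) $ \<gamma>" for \<gamma>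
  proof -
    let ?A' = "mpd \<gamma> (\<lambda>z. cof (J z)) q" and ?K = "conformal_part g (dtr q) \<gamma> q"
    have "dq \<gamma> H (q, p) = (1/2) * (p \<bullet> ((?A' ** ?h + ?A ** mpd \<gamma> (\<lambda>z. matrix_inv (g z)) q) *v p)) + pd \<gamma> W q"
      unfolding H_def
      by (subst dq_quadratic) (use dA dh W in \<open>auto simp: mpd_mult entries_differentiable_mult\<close>)
    moreover have "pd \<gamma> W q = - (\<mu> q v* ?A) $ \<gamma>"
      using W(2) by (simp add: d0_def vec_eq_iff)
    moreover have "?D * (p \<bullet> ((?A' ** ?h) *v p)) = ?D * (p \<bullet> (?A *v (?G \<gamma> *v u p))) - ?D * (p \<bullet> (?G \<gamma> *v (?A *v u p)))
        + (dtr q v* ?A) $ \<gamma> * (p \<bullet> (?A *v u p)) - (dtr q \<bullet> (?A *v u p)) * (p v* ?A) $ \<gamma>"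
    proof -
      \<comment> \<open>By \<open>pAh\<close> and \<open>gA\<close> the two halves of the conformal
        part are equal, so the factor 1/2 disappears.\<close>
      have K: "p \<bullet> (?A *v (?K *v (?A *v u p))) = (dtr q \<bullet> (?A *v u p)) * (p v* ?A) $ \<gamma>"
        unfolding dot_lmul_matrix[symmetric, of p ?A] inner_conformal_part gA
        by (simp add: dot_lmul_matrix pAh inner_commute)
      have "?D * (p \<bullet> ((?A' ** ?h) *v p)) = p \<bullet> ((?D *\<^sub>R ?A') *v u p)"
        by (simp add: u_def matrix_vector_mul_assoc[symmetric] scaleR_matrix_vector_assoc[symmetric])
      also have "\<dots> = ?D * (p \<bullet> (?A *v (?G \<gamma> *v u p))) - ?D * (p \<bullet> (?G \<gamma> *v (?A *v u p)))
          + (dtr q v* ?A) $ \<gamma> * (p \<bullet> (?A *v u p)) - p \<bullet> (?A *v (?K *v (?A *v u p)))"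
        unfolding mpd_cof_tensor[OF q]
        by (simp add: matrix_vector_mult_add_rdistrib matrix_vector_mult_diff_rdistrib inner_add_right
            inner_diff_right scaleR_matrix_vector_assoc[symmetric] matrix_vector_mul_assoc[symmetric] right_diff_distrib)
      finally show ?thesis by (simp add: K)
    qed
    moreover have "p \<bullet> ((?A ** mpd \<gamma> (\<lambda>z. matrix_inv (g z)) q) *v p)
        = - (p \<bullet> (?G \<gamma> *v (?A *v u p))) - p \<bullet> (?A *v (?G \<gamma> *v u p))"
    proof -
      have "(?A ** mpd \<gamma> (\<lambda>z. matrix_inv (g z)) q) *v p
          = - (?A *v (?h *v (p v* ?G \<gamma>))) - ?A *v (?G \<gamma> *v u p)"
        unfolding mpd_metric_inv[OF q(1)]
        by (simp add: u_def matrix_vector_mult_diff_rdistrib matrix_vector_mul_assoc[symmetric]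
            matrix_vector_mult_diff_distrib uminus_matrix_vector_mult matrix_vector_mult_uminus)
      then show ?thesis
        by (simp add: inner_diff_right pAh) (simp add: inner_commute[of "?A *v u p"] dot_lmul_matrix)
    qed
    moreover have "horizontal g H (q, p) $ \<gamma> = dq \<gamma> H (q, p) + p \<bullet> (?G \<gamma> *v (?A *v u p))"
      by (simp add: horizontal_def dqv_def dpv christoffel_form_apply)
    ultimately show ?thesis
      by (simp add: matrix_vector_mult_add_rdistrib inner_add_right) (simp add: field_simps)
  qed
  then show "(2 * ?D) *\<^sub>R horizontal g H (q, p) = (p \<bullet> (?A *v u p)) *\<^sub>R (dtr q v* ?A)
      - (dtr q \<bullet> (?A *v u p)) *\<^sub>R (p v* ?A) - (2 * ?D) *\<^sub>R (\<mu> q v* ?A)"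
    by (simp add: vec_eq_iff)
qed

text \<open>Paired with u, the two terms of \<open>horizontal_cof\<close> containing dtr cancel. The
  remaining term is the opposite of the work of \<mu> along the fibre derivative, so conservation
  follows at once.\<close>

lemma inner_horizontal_cof:
  assumes "q \<in> U" "det (J q) \<noteq> 0" "W differentiable (at q)" "d0 W q = - (\<mu> q v* cof (J q))"
  shows "(matrix_inv (g q) *v p) \<bullet> horizontal g (quadratic (\<lambda>z. cof (J z) ** matrix_inv (g z)) W) (q, p)
    = - (\<mu> q \<bullet> (cof (J q) *v (matrix_inv (g q) *v p)))"
proof -
  let ?u = "matrix_inv (g q) *v p"
  have "(2 * det (J q)) * (?u \<bullet> horizontal g (quadratic (\<lambda>z. cof (J z) ** matrix_inv (g z)) W) (q, p))
      = (2 * det (J q)) * - (\<mu> q \<bullet> (cof (J q) *v ?u))"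
    unfolding inner_scaleR_right[symmetric] horizontal_cof(2)[of q W \<mu>, OF assms]
    by (simp add: inner_diff_right inner_commute[of ?u] dot_lmul_matrix)
  then show ?thesis using assms(2) by (simp only: mult_cancel_left) simp
qed

lemma Gamma_hat_cof:
  assumes "q \<in> U" "det (J q) \<noteq> 0" "W differentiable (at q)" "d0 W q = - (\<mu> q v* cof (J q))"
  shows "Gamma_hat g \<mu> (quadratic (\<lambda>z. cof (J z) ** matrix_inv (g z)) W) (q, p) = 0"
  unfolding Gamma_hat_horizontal[OF assms(1)] inner_horizontal_cof[of q W \<mu>, OF assms]
    horizontal_cof(1)[of q W \<mu>, OF assms] by simp

end

section \<open>The pencil\<close>

lemma mat_vector_mult: "mat c *v x = c *\<^sub>R x" for x :: "real ^ 'k::finite"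
  by (simp add: matrix_vector_mult_def mat_def vec_eq_iff if_distrib if_distribR cong: if_cong)

text \<open>The resolvent identity is applied to the covectors \<alpha>, p and \<mu> in turn. In the
  second claim, J A u = D u - a P A u (and likewise for B) reduces J to P and to the pairings of
  \<xi> and \<eta> with u, in which the \<alpha> terms cancel.\<close>

lemma pencil_involution:
  fixes A B J P :: "real ^ 'k::finite ^ 'k" and p u \<alpha> \<mu> \<xi> \<eta> :: "real ^ 'k"
  assumes ab: "a \<noteq> b" and D: "D \<noteq> 0" "E \<noteq> 0"
    and A: "(J + a *\<^sub>R P) ** A = mat D" "A ** (J + a *\<^sub>R P) = mat D"
    and B: "(J + b *\<^sub>R P) ** B = mat E" "B ** (J + b *\<^sub>R P) = mat E"
    and \<xi>: "(2 * D) *\<^sub>R \<xi> = (p \<bullet> (A *v u)) *\<^sub>R (\<alpha> v* A) - (\<alpha> \<bullet> (A *v u)) *\<^sub>R (p v* A) - (2 * D) *\<^sub>R (\<mu> v* A)"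
    and \<eta>: "(2 * E) *\<^sub>R \<eta> = (p \<bullet> (B *v u)) *\<^sub>R (\<alpha> v* B) - (\<alpha> \<bullet> (B *v u)) *\<^sub>R (p v* B) - (2 * E) *\<^sub>R (\<mu> v* B)"
  shows "\<eta> \<bullet> (P *v (A *v u)) = \<xi> \<bullet> (P *v (B *v u))" (is ?P)
    and "\<eta> \<bullet> (J *v (A *v u)) - \<xi> \<bullet> (J *v (B *v u))
      = (1/2) * ((\<alpha> \<bullet> (A *v u)) * (p \<bullet> (B *v u)) - (\<alpha> \<bullet> (B *v u)) * (p \<bullet> (A *v u)))" (is ?J)
proof -
  let ?x = "\<alpha> \<bullet> (A *v u)" and ?y = "\<alpha> \<bullet> (B *v u)" and ?s = "p \<bullet> (A *v u)" and ?t = "p \<bullet> (B *v u)"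
    and ?m = "\<mu> \<bullet> (A *v u)" and ?n = "\<mu> \<bullet> (B *v u)"
  have BPA: "(b - a) *\<^sub>R (B ** P ** A) = E *\<^sub>R A - D *\<^sub>R B"
  proof -
    have "(b - a) *\<^sub>R (B ** P ** A) = B ** (J + b *\<^sub>R P) ** A - B ** ((J + a *\<^sub>R P) ** A)"
      by (simp add: matrix_distribs scaleR_diff_left)
    then show ?thesis by (simp add: A B mat_mult_scaleR)
  qed
  have APB: "(b - a) *\<^sub>R (A ** P ** B) = E *\<^sub>R A - D *\<^sub>R B"
  proof -
    have "(b - a) *\<^sub>R (A ** P ** B) = A ** ((J + b *\<^sub>R P) ** B) - A ** (J + a *\<^sub>R P) ** B"
      by (simp add: matrix_distribs scaleR_diff_left)
    then show ?thesis by (simp add: A B mat_mult_scaleR)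
  qed
  have vBPA: "(b - a) * ((\<zeta> v* B) \<bullet> (P *v (A *v u))) = E * (\<zeta> \<bullet> (A *v u)) - D * (\<zeta> \<bullet> (B *v u))" for \<zeta>
  proof -
    have "(b - a) * ((\<zeta> v* B) \<bullet> (P *v (A *v u))) = \<zeta> \<bullet> (((b - a) *\<^sub>R (B ** P ** A)) *v u)"
      by (simp add: dot_lmul_matrix matrix_vector_mul_assoc scaleR_matrix_vector_assoc[symmetric] matrix_mul_assoc)
    then show ?thesis
      by (simp add: BPA matrix_vector_mult_diff_rdistrib scaleR_matrix_vector_assoc[symmetric] inner_diff_right)
  qed
  have vAPB: "(b - a) * ((\<zeta> v* A) \<bullet> (P *v (B *v u))) = E * (\<zeta> \<bullet> (A *v u)) - D * (\<zeta> \<bullet> (B *v u))" for \<zeta>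
  proof -
    have "(b - a) * ((\<zeta> v* A) \<bullet> (P *v (B *v u))) = \<zeta> \<bullet> (((b - a) *\<^sub>R (A ** P ** B)) *v u)"
      by (simp add: dot_lmul_matrix matrix_vector_mul_assoc scaleR_matrix_vector_assoc[symmetric] matrix_mul_assoc)
    then show ?thesis
      by (simp add: APB matrix_vector_mult_diff_rdistrib scaleR_matrix_vector_assoc[symmetric] inner_diff_right)
  qed
  \<comment> \<open>The common value of both sides of the first claim times b - a. Expanding with
    \<open>vBPA\<close> cancels the terms in \<open>?y * ?t\<close>, so that E can be divided out;
    on the other side those in \<open>?x * ?s\<close> cancel and D can be divided out.\<close>
  define z where "z = (1/2) * (?x * ?t - ?y * ?s) - (E * ?m - D * ?n)"
  have "2 * E * ((b - a) * (\<eta> \<bullet> (P *v (A *v u)))) = (b - a) * (((2 * E) *\<^sub>R \<eta>) \<bullet> (P *v (A *v u)))"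
    by simp
  also have "\<dots> = ?t * ((b - a) * ((\<alpha> v* B) \<bullet> (P *v (A *v u)))) - ?y * ((b - a) * ((p v* B) \<bullet> (P *v (A *v u))))
      - 2 * E * ((b - a) * ((\<mu> v* B) \<bullet> (P *v (A *v u))))"
    unfolding \<eta> by (simp add: inner_diff_left algebra_simps)
  also have "\<dots> = 2 * E * z" unfolding vBPA z_def by (simp add: field_simps)
  finally have \<eta>P: "(b - a) * (\<eta> \<bullet> (P *v (A *v u))) = z" using D by simp
  have "2 * D * ((b - a) * (\<xi> \<bullet> (P *v (B *v u)))) = (b - a) * (((2 * D) *\<^sub>R \<xi>) \<bullet> (P *v (B *v u)))"
    by simp
  also have "\<dots> = ?s * ((b - a) * ((\<alpha> v* A) \<bullet> (P *v (B *v u)))) - ?x * ((b - a) * ((p v* A) \<bullet> (P *v (B *v u))))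
      - 2 * D * ((b - a) * ((\<mu> v* A) \<bullet> (P *v (B *v u))))"
    unfolding \<xi> by (simp add: inner_diff_left algebra_simps)
  also have "\<dots> = 2 * D * z" unfolding vAPB z_def by (simp add: field_simps)
  finally have \<xi>P: "(b - a) * (\<xi> \<bullet> (P *v (B *v u))) = z" using D by simp
  have "(b - a) * (\<eta> \<bullet> (P *v (A *v u))) = (b - a) * (\<xi> \<bullet> (P *v (B *v u)))" by (simp only: \<eta>P \<xi>P)
  then show ?P using ab by simp
  have "2 * E * (\<eta> \<bullet> u) = ((2 * E) *\<^sub>R \<eta>) \<bullet> u" by simp
  also have "\<dots> = 2 * E * - ?n" unfolding \<eta> by (simp add: inner_diff_left dot_lmul_matrix)
  finally have \<eta>u: "\<eta> \<bullet> u = - ?n" using D by (simp only: mult_cancel_left) simp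
  have "2 * D * (\<xi> \<bullet> u) = ((2 * D) *\<^sub>R \<xi>) \<bullet> u" by simp
  also have "\<dots> = 2 * D * - ?m" unfolding \<xi> by (simp add: inner_diff_left dot_lmul_matrix)
  finally have \<xi>u: "\<xi> \<bullet> u = - ?m" using D by (simp only: mult_cancel_left) simp
  have "((J + a *\<^sub>R P) ** A) *v u = D *\<^sub>R u" "((J + b *\<^sub>R P) ** B) *v u = E *\<^sub>R u"
    unfolding A B by (rule mat_vector_mult)+
  then have "J *v (A *v u) = D *\<^sub>R u - a *\<^sub>R (P *v (A *v u))" "J *v (B *v u) = E *\<^sub>R u - b *\<^sub>R (P *v (B *v u))"
    by (simp_all add: matrix_vector_mul_assoc[symmetric] matrix_vector_mult_add_rdistrib
        scaleR_matrix_vector_assoc[symmetric] eq_diff_eq)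
  then have "\<eta> \<bullet> (J *v (A *v u)) - \<xi> \<bullet> (J *v (B *v u))
      = D * (\<eta> \<bullet> u) - E * (\<xi> \<bullet> u) + (b * (\<xi> \<bullet> (P *v (B *v u))) - a * (\<eta> \<bullet> (P *v (A *v u))))"
    by (simp add: inner_diff_right)
  also have "b * (\<xi> \<bullet> (P *v (B *v u))) - a * (\<eta> \<bullet> (P *v (A *v u))) = z"
    using \<open>?P\<close> \<eta>P by (simp add: left_diff_distrib)
  finally show ?J unfolding \<eta>u \<xi>u z_def by (simp add: algebra_simps)
qed

section \<open>Linearity in the tensor\<close>

lemma mpd_add_scaleR:
  assumes "entries_differentiable S q" "entries_differentiable T q"
  shows "mpd \<gamma> (\<lambda>z. S z + a *\<^sub>R T z) q = mpd \<gamma> S q + a *\<^sub>R mpd \<gamma> T q"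
  using assms by (simp add: mpd_def vec_eq_iff entries_differentiable_def pd_add pd_cmult differentiable_mult)

lemma d0_trace_add_scaleR:
  assumes "entries_differentiable S q" "entries_differentiable T q"
  shows "d0 (\<lambda>z. trace (S z + a *\<^sub>R T z)) q = d0 (\<lambda>z. trace (S z)) q + a *\<^sub>R d0 (\<lambda>z. trace (T z)) q"
proof -
  have "(\<lambda>z. S z $ i $ i) differentiable (at q)" "(\<lambda>z. T z $ i $ i) differentiable (at q)" for i
    using assms by (simp_all add: entries_differentiable_def)
  then show ?thesis
    by (simp add: d0_def vec_eq_iff trace_def pd_sum pd_add pd_cmult differentiable_mult differentiable_add
        sum.distrib sum_distrib_left)
qed

lemma transpose_add_scaleR: "transpose (A + a *\<^sub>R B) = transpose A + a *\<^sub>R transpose B" for A B :: "real ^ _ ^ _"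
  by (simp add: transpose_def vec_eq_iff)

lemma D_J_add_scaleR:
  assumes "entries_differentiable S q" "entries_differentiable T q"
  shows "D_J (\<lambda>z. S z + a *\<^sub>R T z) \<rho> q = D_J S \<rho> q + a *\<^sub>R D_J T \<rho> q"
  by (simp add: vec_eq_iff[of "D_J _ _ _"] vec_eq_iff[of "D_J _ _ _ $ _"] D_J_nth mpd_add_scaleR assms d0_trace_add_scaleR
      transpose_add_scaleR matrix_add_rdistrib scalar_matrix_assoc[symmetric] vector_matrix_mult_add_rdistrib
      vector_matrix_scaleR_right wedge_def) (simp add: algebra_simps)

context riemannian_domain
begin

lemma scKt_add_scaleR:
  assumes "scKt U g S" "scKt U g T"
  shows "scKt U g (\<lambda>z. S z + a *\<^sub>R T z)"
proof -
  interpret S: scKt_domain U g S by unfold_locales (rule assms)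
  interpret T: scKt_domain U g T by unfold_locales (rule assms)
  show ?thesis
    unfolding scKt_def
  proof (intro conjI ballI allI)
    show "smooth_tensor U (\<lambda>z. S z + a *\<^sub>R T z)"
      using assms by (auto simp: scKt_def smooth_tensor_def
          intro!: smooth_fn_add[OF open_U] smooth_fn_mult[OF open_U] smooth_fn_const)
  next
    fix q assume q: "q \<in> U"
    show "transpose (g q ** (S q + a *\<^sub>R T q)) = g q ** (S q + a *\<^sub>R T q)"
      using assms q by (simp add: scKt_def matrix_distribs transpose_add_scaleR)
  next
    fix q \<alpha> \<beta> \<gamma> assume q: "q \<in> U"
    note diff = S.tensor_differentiable[OF q] T.tensor_differentiable[OF q]
    have sum_diff: "entries_differentiable (\<lambda>z. S z + a *\<^sub>R T z) q"
      using diff by (simp add: entries_differentiable_def differentiable_add differentiable_mult)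
    have "cov_deriv g (\<lambda>z. g z ** (S z + a *\<^sub>R T z)) \<alpha> \<beta> \<gamma> q
        = cov_deriv g (\<lambda>z. g z ** S z) \<alpha> \<beta> \<gamma> q + a * cov_deriv g (\<lambda>z. g z ** T z) \<alpha> \<beta> \<gamma> q"
      unfolding cov_deriv_metric_mult[OF q sum_diff] cov_deriv_metric_mult[OF q diff(1)]
        cov_deriv_metric_mult[OF q diff(2)]
      by (simp add: diff mpd_add_scaleR matrix_distribs) (simp add: algebra_simps)
    also have "\<dots> = 1 / 2 * (d0 (\<lambda>z. trace (S z + a *\<^sub>R T z)) q $ \<alpha> * g q $ \<beta> $ \<gamma>
        + d0 (\<lambda>z. trace (S z + a *\<^sub>R T z)) q $ \<beta> * g q $ \<alpha> $ \<gamma>)"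
      using assms q unfolding scKt_def by (simp add: d0_trace_add_scaleR diff) (simp add: algebra_simps)
    finally show "cov_deriv g (\<lambda>z. g z ** (S z + a *\<^sub>R T z)) \<alpha> \<beta> \<gamma> q
        = 1 / 2 * (d0 (\<lambda>z. trace (S z + a *\<^sub>R T z)) q $ \<alpha> * g q $ \<beta> $ \<gamma>
        + d0 (\<lambda>z. trace (S z + a *\<^sub>R T z)) q $ \<beta> * g q $ \<alpha> $ \<gamma>)" .
  qed
qed

end

section \<open>Coefficients from regular parameters\<close>

lemma eq_0_if_power_sum_eq_0:
  fixes c :: "nat \<Rightarrow> real"
  assumes "finite S" "\<And>a. a \<notin> S \<Longrightarrow> (\<Sum>i = 1..N. a ^ (i - 1) * c i) = 0" "i \<in> {1..N}"
  shows "c i = 0"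
proof -
  define P where "P = (\<Sum>i = 1..N. monom (c i) (i - 1))"
  have "poly P a = 0" if "a \<notin> S" for a
    using assms(2)[OF that] by (simp add: P_def poly_sum poly_monom mult.commute)
  then have "UNIV - S \<subseteq> {a. poly P a = 0}" by auto
  then have "P = 0"
    using assms(1) poly_roots_finite[of P] infinite_UNIV_char_0 by (metis Diff_infinite_finite finite_subset)
  then have "0 = coeff P (i - 1)" by simp
  \<comment> \<open>Truncated subtraction of 1 is injective on {1..N}, so exactly one monomial has
    degree \<open>i - 1\<close>.\<close>
  also have "\<dots> = (\<Sum>k = 1..N. if k = i then c k else 0)"
    unfolding P_def coeff_sum by (rule sum.cong) (use assms(3) in auto)
  also have "\<dots> = c i" using assms(3) by simp
  finally show ?thesis by simp
qed

lemma finite_singular_pencil: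
  fixes A B :: "real ^ 'k::finite ^ 'k"
  assumes "det A \<noteq> 0"
  shows "finite {a. det (A + a *\<^sub>R B) = 0}"
proof -
  define M where "M = (\<chi> i j. [:A $ i $ j, B $ i $ j:])"
  have "poly (det M) a = det (A + a *\<^sub>R B)" for a
    by (simp add: det_def M_def poly_sum poly_mult poly_prod)
  moreover from this[of 0] have "det M \<noteq> 0" using assms by auto
  ultimately show ?thesis using poly_roots_finite[of "det M"] by simp
qed

section \<open>The projector P2 and block matrices\<close>

lemma P2_nth: "P2 $ \<alpha> $ \<beta> = (if \<alpha> = \<beta> \<and> \<not> isl \<alpha> then 1 else 0)"
  by (auto simp: P2_def split: sum.splits)

lemma mult_P2_nth: "(M ** P2) $ \<alpha> $ \<beta> = (if isl \<beta> then 0 else M $ \<alpha> $ \<beta>)"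
proof -
  have "(M ** P2) $ \<alpha> $ \<beta> = (\<Sum>k\<in>UNIV. if k = \<beta> then (if isl \<beta> then 0 else M $ \<alpha> $ \<beta>) else 0)"
    unfolding matrix_matrix_mult_def vec_lambda_beta by (rule sum.cong) (auto simp: P2_nth)
  then show ?thesis by simp
qed

lemma P2_mult_nth: "(P2 ** M) $ \<alpha> $ \<beta> = (if isl \<alpha> then 0 else M $ \<alpha> $ \<beta>)"
proof -
  have "(P2 ** M) $ \<alpha> $ \<beta> = (\<Sum>k\<in>UNIV. if k = \<alpha> then (if isl \<alpha> then 0 else M $ \<alpha> $ \<beta>) else 0)"
    unfolding matrix_matrix_mult_def vec_lambda_beta by (rule sum.cong) (auto simp: P2_nth)
  then show ?thesis by simp
qed

text \<open>Block-diagonal matrices commute with the projector. In this form the product structure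
  of the metric passes through matrix products and inverses without indices.\<close>

lemma P2_commute:
  assumes "\<And>i a. M $ Inl i $ Inr a = 0" "\<And>i a. M $ Inr a $ Inl i = 0"
  shows "M ** P2 = P2 ** M"
proof -
  have "(M ** P2) $ \<alpha> $ \<beta> = (P2 ** M) $ \<alpha> $ \<beta>" for \<alpha> \<beta>
    by (cases \<alpha>; cases \<beta>) (simp_all add: mult_P2_nth P2_mult_nth assms)
  then show ?thesis by (simp add: vec_eq_iff)
qed

section \<open>Driven cofactor systems\<close>

lemma transpose_P2: "transpose P2 = P2"
  by (auto simp: transpose_def vec_eq_iff P2_nth)

lemma zero_matrix_mult: "(0 :: real ^ 'b ^ 'a::finite) ** B = 0" for B :: "real ^ 'c::finite ^ 'b::finite"
  by (simp add: matrix_matrix_mult_def vec_eq_iff)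

lemma matrix_mult_zero: "A ** (0 :: real ^ 'c ^ 'b) = 0" for A :: "real ^ 'b::finite ^ 'a::finite"
  by (simp add: matrix_matrix_mult_def vec_eq_iff)

lemma sum_scaleR_matrix_mult: "(\<Sum>i\<in>I. c i *\<^sub>R A i) ** B = (\<Sum>i\<in>I. c i *\<^sub>R (A i ** B))"
  for B :: "real ^ 'a::finite ^ 'b::finite" and A :: "_ \<Rightarrow> real ^ 'b ^ 'd::finite"
  by (induction I rule: infinite_finite_induct)
    (simp_all add: zero_matrix_mult matrix_add_rdistrib scalar_matrix_assoc[symmetric])

lemma sum_scaleR_matrix_vector: "(\<Sum>i\<in>I. c i *\<^sub>R A i) *v x = (\<Sum>i\<in>I. c i *\<^sub>R (A i *v x))"
  for x :: "real ^ 'a::finite" and A :: "_ \<Rightarrow> real ^ 'a ^ 'd::finite"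
  by (induction I rule: infinite_finite_induct)
    (simp_all add: matrix_vector_mult_add_rdistrib scaleR_matrix_vector_assoc[symmetric])

lemma vector_matrix_sum_scaleR: "x v* (\<Sum>i\<in>I. c i *\<^sub>R A i) = (\<Sum>i\<in>I. c i *\<^sub>R (x v* A i))"
  for x :: "real ^ 'd::finite" and A :: "_ \<Rightarrow> real ^ 'a::finite ^ 'd::finite"
  by (induction I rule: infinite_finite_induct)
    (simp_all add: vector_matrix_mult_add_rdistrib vector_matrix_scaleR_right)

text \<open>The generating function of the integrals is the quadratic function of the pencil, so
  results on one special conformal Killing tensor can be expanded in powers of
  \<open>a\<close>.\<close>

lemma quadratic_cof_pencil:
  "quadratic (\<lambda>q. cof (J q + a *\<^sub>R P2) ** matrix_inv (g q)) (\<lambda>q. \<Sum>i = 1..CARD('n) + 1. a ^ (i - 1) * W i q)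
    = (\<lambda>z. \<Sum>i = 1..CARD('n) + 1. a ^ (i - 1) * H_fn g J i (W i) z)"
  for J :: "real ^ ('m::finite + 'n::finite) \<Rightarrow> real ^ ('m + 'n) ^ ('m + 'n)"
proof
  fix z :: "(real ^ ('m + 'n)) \<times> (real ^ ('m + 'n))"
  obtain q p where z: "z = (q, p)" by (cases z)
  show "quadratic (\<lambda>q. cof (J q + a *\<^sub>R P2) ** matrix_inv (g q)) (\<lambda>q. \<Sum>i = 1..CARD('n) + 1. a ^ (i - 1) * W i q) z
      = (\<Sum>i = 1..CARD('n) + 1. a ^ (i - 1) * H_fn g J i (W i) z)"
    unfolding z H_fn_quadratic quadratic_inner A_coef_expansion sum_scaleR_matrix_mult sum_scaleR_matrix_vector
      inner_sum_right inner_scaleR_right distrib_left sum.distrib sum_distrib_left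
    by (simp add: mult.left_commute)
qed

lemma eq_0_if_double_power_sum_eq_0:
  fixes c :: "nat \<Rightarrow> nat \<Rightarrow> real"
  assumes "finite S" and 0: "\<And>a b. a \<notin> S \<Longrightarrow> b \<notin> S \<Longrightarrow> a \<noteq> b \<Longrightarrow>
      (\<Sum>i = 1..N. a ^ (i - 1) * (\<Sum>l = 1..N. b ^ (l - 1) * c i l)) = 0"
    and "i \<in> {1..N}" "l \<in> {1..N}"
  shows "c i l = 0"
proof -
  have swap: "(\<Sum>i = 1..N. a ^ (i - 1) * (\<Sum>l = 1..N. b ^ (l - 1) * c i l))
      = (\<Sum>l = 1..N. b ^ (l - 1) * (\<Sum>i = 1..N. a ^ (i - 1) * c i l))" for a b
    by (simp add: sum_distrib_left mult.left_commute) (rule sum.swap)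
  \<comment> \<open>With \<open>a\<close> fixed, the condition that b differs from a costs only one
    more exceptional value, hence \<open>insert a S\<close>.\<close>
  have "(\<Sum>i = 1..N. a ^ (i - 1) * c i l) = 0" if "a \<notin> S" for a
    by (rule eq_0_if_power_sum_eq_0[where S = "insert a S" and N = N
          and c = "\<lambda>l. \<Sum>i = 1..N. a ^ (i - 1) * c i l"])
      (use assms(1,4) 0[unfolded swap] that in auto)
  then show ?thesis
    by (rule eq_0_if_power_sum_eq_0[OF assms(1) _ assms(3)])
qed

locale driven_domain =
  fixes U :: "(real ^ ('m::finite + 'n::finite)) set"
    and g J :: "real ^ ('m + 'n) \<Rightarrow> real ^ ('m + 'n) ^ ('m + 'n)"
    and \<mu> :: "real ^ ('m + 'n) \<Rightarrow> real ^ ('m + 'n)"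
  assumes domain: "coordinate_domain U" and driven: "driven_cofactor_system U g \<mu> J"
begin

lemma cofactor: "cofactor_system U g \<mu> J"
  using driven by (simp add: driven_cofactor_system_def)

sublocale riemannian_domain U g
  using domain cofactor by unfold_locales (simp_all add: coordinate_domain_def cofactor_system_def)

sublocale scKt_domain U g J
  using cofactor by unfold_locales (simp add: cofactor_system_def)

lemma mu_differentiable: "q \<in> U \<Longrightarrow> (\<lambda>z. \<mu> z $ \<alpha>) differentiable (at q)"
  using cofactor by (auto simp: cofactor_system_def smooth_form_def intro: smooth_fn_differentiable)

lemma metric_mixed: "q \<in> U \<Longrightarrow> g q $ Inl i $ Inr a = 0" "q \<in> U \<Longrightarrow> g q $ Inr a $ Inl i = 0"
  using driven by (simp_all add: driven_cofactor_system_def)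

lemma metric_P2: "q \<in> U \<Longrightarrow> g q ** P2 = P2 ** g q"
  by (rule P2_commute) (simp_all add: metric_mixed)

lemma pd_Inr_eq_0_if_function_of_y:
  assumes "q \<in> U" "function_of_y U f" "f differentiable (at q)"
  shows "pd (Inr a) f q = 0"
proof (rule pd_eq_0_if_constant_along[OF open_U assms(1,3)])
  fix t assume "q + t *\<^sub>R axis (Inr a) 1 \<in> U"
  moreover have "(q + t *\<^sub>R axis (Inr a) 1) $ Inl j = q $ Inl j" for j by (simp add: axis_def)
  ultimately show "f (q + t *\<^sub>R axis (Inr a) 1) = f q"
    using assms(1,2) unfolding function_of_y_def by blast
qed

lemma pd_Inl_eq_0_if_function_of_x:
  assumes "q \<in> U" "function_of_x U f" "f differentiable (at q)"
  shows "pd (Inl i) f q = 0"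
proof (rule pd_eq_0_if_constant_along[OF open_U assms(1,3)])
  fix t assume "q + t *\<^sub>R axis (Inl i) 1 \<in> U"
  moreover have "(q + t *\<^sub>R axis (Inl i) 1) $ Inr b = q $ Inr b" for b by (simp add: axis_def)
  ultimately show "f (q + t *\<^sub>R axis (Inl i) 1) = f q"
    using assms(1,2) unfolding function_of_x_def by blast
qed

text \<open>The mixed symbols of the first kind vanish: each term differentiates either a mixed
  entry of g or one block in a direction of the other factor. As P2 also commutes with the inverse
  metric, it is parallel.\<close>

lemma christoffel_matrix_P2:
  assumes q: "q \<in> U"
  shows "christoffel_matrix g \<gamma> q ** P2 = P2 ** christoffel_matrix g \<gamma> q"
proof -
  let ?L = "g q ** christoffel_matrix g \<gamma> q" and ?h = "matrix_inv (g q)"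
  have diff: "(\<lambda>z. g z $ \<alpha> $ \<beta>) differentiable (at q)" for \<alpha> \<beta>
    using metric_differentiable[OF q] by (simp add: entries_differentiable_def)
  have mixed: "pd \<delta> (\<lambda>z. g z $ Inl i $ Inr a) q = 0" "pd \<delta> (\<lambda>z. g z $ Inr a $ Inl i) q = 0" for \<delta> i a
    using pd_cong[OF open_U q, of "\<lambda>z. g z $ Inl i $ Inr a" "\<lambda>_. 0" \<delta>]
      pd_cong[OF open_U q, of "\<lambda>z. g z $ Inr a $ Inl i" "\<lambda>_. 0" \<delta>] by (simp_all add: metric_mixed)
  have block: "pd (Inr a) (\<lambda>z. g z $ Inl i $ Inl j) q = 0" "pd (Inl i) (\<lambda>z. g z $ Inr a $ Inr b) q = 0" for i j a b
    using driven q diff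
    by (auto simp: driven_cofactor_system_def intro!: pd_Inr_eq_0_if_function_of_y pd_Inl_eq_0_if_function_of_x)
  have L: "?L ** P2 = P2 ** ?L"
    by (rule P2_commute; cases \<gamma>) (simp_all add: metric_christoffel q mixed block)
  have h: "?h ** P2 = P2 ** ?h"
  proof -
    have "?h ** P2 = ?h ** (P2 ** g q) ** ?h"
      by (simp add: matrix_mul_assoc[symmetric] metric_inv q)
    also have "\<dots> = ?h ** g q ** P2 ** ?h"
      by (simp add: metric_P2[OF q, symmetric] matrix_mul_assoc)
    finally show ?thesis by (simp add: metric_inv q)
  qed
  have G: "christoffel_matrix g \<gamma> q = ?h ** ?L" by (simp add: matrix_mul_assoc metric_inv q)
  have "?h ** ?L ** P2 = ?h ** (P2 ** ?L)" by (subst L[symmetric]) (simp only: matrix_mul_assoc)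
  also have "\<dots> = P2 ** (?h ** ?L)" by (simp only: h matrix_mul_assoc)
  finally show ?thesis using G by metis
qed

lemma scKt_P2: "scKt U g (\<lambda>_. P2)"
  unfolding scKt_def
proof (intro conjI ballI allI)
  show "smooth_tensor U (\<lambda>_. P2)" by (simp add: smooth_tensor_def smooth_fn_const)
next
  fix q assume q: "q \<in> U"
  show "transpose (g q ** P2) = g q ** P2"
    by (simp add: matrix_transpose_mul metric_sym q transpose_P2 metric_P2)
next
  fix q \<alpha> \<beta> \<gamma> assume q: "q \<in> U"
  have "mpd \<gamma> (\<lambda>_. P2 :: real ^ ('m + 'n) ^ ('m + 'n)) q = 0" by (simp add: mpd_def vec_eq_iff)
  moreover have "entries_differentiable (\<lambda>_. P2 :: real ^ ('m + 'n) ^ ('m + 'n)) q" by (simp add: entries_differentiable_def)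
  ultimately have "cov_deriv g (\<lambda>z. g z ** P2) \<alpha> \<beta> \<gamma> q = 0"
    using cov_deriv_metric_mult[OF q, of "\<lambda>_. P2"] by (simp add: christoffel_matrix_P2 q matrix_mult_zero)
  then show "cov_deriv g (\<lambda>z. g z ** P2) \<alpha> \<beta> \<gamma> q =
      1 / 2 * (d0 (\<lambda>z. trace P2) q $ \<alpha> * g q $ \<beta> $ \<gamma> + d0 (\<lambda>z. trace P2) q $ \<beta> * g q $ \<alpha> $ \<gamma>)"
    by (simp add: d0_def)
qed

text \<open>Only the antisymmetrized x-rows of the Jacobian of \<mu> survive. The x-x entries cancel
  because the x-part of \<mu> is minus the x-gradient of V; the mixed ones vanish because the
  y-components do not depend on x. The y-derivatives of the x-components are killed by P2.\<close>

lemma D_J_P2: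
  assumes q: "q \<in> U"
  shows "D_J (\<lambda>_. P2) \<mu> q = 0"
proof -
  obtain V where V: "smooth_fn U V" "\<And>q a. q \<in> U \<Longrightarrow> \<mu> q $ Inr a = - pd (Inr a) V q"
    using driven unfolding driven_cofactor_system_def by blast
  have "Ck_fn (Suc (Suc 0)) U V" using V(1) unfolding smooth_fn_def by blast
  then have "pd \<alpha> V differentiable (at q)" for \<alpha> using q by simp
  then have mu_V: "pd \<gamma> (\<lambda>z. \<mu> z $ Inr a) q = - pd \<gamma> (pd (Inr a) V) q" for \<gamma> a
    using pd_cong[OF open_U q, of "\<lambda>z. \<mu> z $ Inr a" "\<lambda>z. - pd (Inr a) V z" \<gamma>] V(2)
    by (simp add: pd_uminus)
  have sym: "pd (Inr a) (\<lambda>z. \<mu> z $ Inr b) q = pd (Inr b) (\<lambda>z. \<mu> z $ Inr a) q" for a b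
    unfolding mu_V using pd_commute[OF open_U q V(1)] by metis
  have y: "pd (Inr a) (\<lambda>z. \<mu> z $ Inl i) q = 0" for a i
    using driven by (intro pd_Inr_eq_0_if_function_of_y[OF q]) (auto simp: driven_cofactor_system_def mu_differentiable q)
  have "mpd \<gamma> (\<lambda>_. P2 :: real ^ ('m + 'n) ^ ('m + 'n)) q = 0" for \<gamma> by (simp add: mpd_def vec_eq_iff)
  then have "D_J (\<lambda>_. P2) \<mu> q $ \<alpha> $ \<beta> = (P2 ** form_jacobian \<mu> q) $ \<alpha> $ \<beta> - (P2 ** form_jacobian \<mu> q) $ \<beta> $ \<alpha>" for \<alpha> \<beta>
    by (simp add: D_J_nth transpose_P2 wedge_def d0_def)
  also have "\<dots> \<alpha> \<beta> = 0" for \<alpha> \<beta>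
    by (cases \<alpha>; cases \<beta>) (simp_all add: P2_mult_nth form_jacobian_def y sym)
  finally show ?thesis by (simp add: vec_eq_iff)
qed

section \<open>Closed forms and potentials of the coefficients\<close>

lemma scKt_pencil: "scKt_domain U g (\<lambda>z. J z + a *\<^sub>R P2)"
  by unfold_locales (rule scKt_add_scaleR[OF scKt scKt_P2])

lemma D_J_pencil: "q \<in> U \<Longrightarrow> D_J (\<lambda>z. J z + a *\<^sub>R P2) \<mu> q = 0"
  using cofactor D_J_P2[of q]
  by (simp add: D_J_add_scaleR tensor_differentiable entries_differentiable_def[of "\<lambda>_. P2 :: real ^ ('m + 'n) ^ ('m + 'n)"] cofactor_system_def)

lemma A_coef_differentiable:
  assumes "q \<in> U"
  shows "(\<lambda>z. A_coef i (J z) $ \<alpha> $ \<beta>) differentiable (at q)"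
proof -
  have "smooth_tensor U J" using scKt by (simp add: scKt_def)
  from smooth_fn_differentiable[OF smooth_fn_A_coef[OF open_U this] assms] show ?thesis .
qed

text \<open>\<open>cof_form_closed\<close> holds for the pencil at every regular parameter. Since
  \<open>d1\<close> is linear over the differentiable coefficient forms, its components are
  polynomials in \<open>a\<close> that vanish outside a finite set.\<close>

lemma A_coef_form_closed:
  assumes q: "q \<in> U" and i: "i \<in> {1..CARD('n) + 1}"
  shows "d1 (\<lambda>z. \<mu> z v* A_coef i (J z)) q = 0"
proof -
  let ?c = "\<lambda>\<alpha> \<beta> i. d1 (\<lambda>z. \<mu> z v* A_coef i (J z)) q $ \<alpha> $ \<beta>"
  have det: "det (J q) \<noteq> 0" using cofactor q by (simp add: cofactor_system_def invertible_det_nz)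
  have diff: "(\<lambda>z. (\<mu> z v* A_coef i (J z)) $ \<alpha>) differentiable (at q)" for i \<alpha>
    unfolding vector_matrix_mult_def vec_lambda_beta
    by (intro differentiable_sum finite ballI differentiable_mult mu_differentiable
        A_coef_differentiable q)
  have zero: "(\<Sum>i = 1..CARD('n) + 1. a ^ (i - 1) * ?c \<alpha> \<beta> i) = 0" if "a \<notin> {a. det (J q + a *\<^sub>R P2) = 0}" for a \<alpha> \<beta>
  proof -
    interpret Ja: scKt_domain U g "\<lambda>z. J z + a *\<^sub>R P2" by (rule scKt_pencil)
    have "d1 (\<lambda>z. \<mu> z v* cof (J z + a *\<^sub>R P2)) q = 0"
      using that by (intro Ja.cof_form_closed q D_J_pencil mu_differentiable) auto
    moreover have "pd \<gamma> (\<lambda>z. (\<mu> z v* cof (J z + a *\<^sub>R P2)) $ \<delta>) q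
        = (\<Sum>i = 1..CARD('n) + 1. a ^ (i - 1) * pd \<gamma> (\<lambda>z. (\<mu> z v* A_coef i (J z)) $ \<delta>) q)" for \<gamma> \<delta>
      unfolding A_coef_expansion vector_matrix_sum_scaleR sum_component vector_scaleR_component
      by (subst pd_sum) (simp_all only: pd_cmult diff differentiable_mult differentiable_const real_scaleR_def)
    ultimately have "0 = (\<Sum>i = 1..CARD('n) + 1. a ^ (i - 1) * pd \<alpha> (\<lambda>z. (\<mu> z v* A_coef i (J z)) $ \<beta>) q)
        - (\<Sum>i = 1..CARD('n) + 1. a ^ (i - 1) * pd \<beta> (\<lambda>z. (\<mu> z v* A_coef i (J z)) $ \<alpha>) q)"
      by (simp only: d1_def vec_eq_iff vec_lambda_beta zero_index)
    then show ?thesis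
      by (simp only: d1_def vec_lambda_beta right_diff_distrib sum_subtractf)
  qed
  have "?c \<alpha> \<beta> i = 0" for \<alpha> \<beta>
    by (rule eq_0_if_power_sum_eq_0[OF finite_singular_pencil[OF det, of P2] _ i, where c = "?c \<alpha> \<beta>"]) (rule zero)
  then show ?thesis by (simp add: vec_eq_iff)
qed

lemma A_coef_potential_exists:
  assumes i: "i \<in> {1..CARD('n) + 1}"
  shows "\<exists>W. is_potential U (\<lambda>q. \<mu> q v* A_coef i (J q)) W"
proof -
  let ?\<rho> = "\<lambda>q. \<mu> q v* A_coef i (J q)"
  have "smooth_tensor U J" "smooth_form U \<mu>" using cofactor by (simp_all add: cofactor_system_def scKt_def)
  then have "smooth_form U ?\<rho>"
    unfolding smooth_form_def vector_matrix_mult_def vec_lambda_beta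
    by (intro allI smooth_fn_sum smooth_fn_mult open_U smooth_fn_A_coef) auto
  then obtain f where f: "smooth_fn U f" "\<And>q. q \<in> U \<Longrightarrow> ?\<rho> q = d0 f q"
    using domain A_coef_form_closed[OF _ i] unfolding coordinate_domain_def by blast
  \<comment> \<open>The domain supplies a primitive, while a potential carries the opposite sign;
    the factor - 1 lets the product rules apply.\<close>
  have "d0 (\<lambda>q. - 1 * f q) q = - d0 f q" if "q \<in> U" for q
    using pd_cmult[OF smooth_fn_differentiable[OF f(1) that], of _ "- 1"] by (simp add: d0_def vec_eq_iff)
  then have "is_potential U ?\<rho> (\<lambda>q. - 1 * f q)"
    unfolding is_potential_def using f smooth_fn_mult[OF open_U smooth_fn_const f(1), of "- 1"] by auto
  then show ?thesis by blast
qed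

lemma d0_trace_pencil: "q \<in> U \<Longrightarrow> d0 (\<lambda>z. trace (J z + a *\<^sub>R P2)) q = dtr q"
  by (simp add: d0_trace_add_scaleR tensor_differentiable entries_differentiable_def[of "\<lambda>_. P2 :: real ^ ('m + 'n) ^ ('m + 'n)"])
    (simp add: d0_def vec_eq_iff)

section \<open>First integrals and involution\<close>

context
  fixes W :: "nat \<Rightarrow> real ^ ('m + 'n) \<Rightarrow> real"
  assumes W: "\<And>i. i \<in> {1..CARD('n) + 1} \<Longrightarrow> is_potential U (\<lambda>q. \<mu> q v* A_coef i (J q)) (W i)"
begin

abbreviation W_pencil :: "real \<Rightarrow> real ^ ('m + 'n) \<Rightarrow> real" where
  "W_pencil a \<equiv> \<lambda>q. \<Sum>i = 1..CARD('n) + 1. a ^ (i - 1) * W i q"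

abbreviation H_pencil :: "real \<Rightarrow> (real ^ ('m + 'n)) \<times> (real ^ ('m + 'n)) \<Rightarrow> real" where
  "H_pencil a \<equiv> quadratic (\<lambda>q. cof (J q + a *\<^sub>R P2) ** matrix_inv (g q)) (W_pencil a)"

lemma W_differentiable: "q \<in> U \<Longrightarrow> i \<in> {1..CARD('n) + 1} \<Longrightarrow> W i differentiable (at q)"
  using W[of i] by (auto simp: is_potential_def intro: smooth_fn_differentiable)

text \<open>Any choice of potentials combines into a potential for the whole pencil, as
  \<open>horizontal_cof\<close> requires.\<close>

lemma W_pencil:
  assumes q: "q \<in> U"
  shows "W_pencil a differentiable (at q)" "d0 (W_pencil a) q = - (\<mu> q v* cof (J q + a *\<^sub>R P2))"
proof -
  have diff: "(\<lambda>q. a ^ (i - 1) * W i q) differentiable (at q)" if "i \<in> {1..CARD('n) + 1}" for i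
    by (intro differentiable_mult differentiable_const W_differentiable q that)
  then show "W_pencil a differentiable (at q)" by (intro differentiable_sum ballI finite_atLeastAtMost)
  have "pd \<gamma> (W_pencil a) q = (\<Sum>i = 1..CARD('n) + 1. a ^ (i - 1) * - (\<mu> q v* A_coef i (J q)) $ \<gamma>)" for \<gamma>
  proof (rule trans[OF pd_sum sum.cong[OF refl]])
    fix i assume i: "i \<in> {1..CARD('n) + 1}"
    then show "(\<lambda>q. a ^ (i - 1) * W i q) differentiable (at q)" by (rule diff)
    have "\<mu> q v* A_coef i (J q) = - d0 (W i) q"
      using W[OF i] q unfolding is_potential_def by blast
    then show "pd \<gamma> (\<lambda>q. a ^ (i - 1) * W i q) q = a ^ (i - 1) * - (\<mu> q v* A_coef i (J q)) $ \<gamma>"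
      by (simp only: pd_cmult[OF W_differentiable[OF q i]] d0_def) simp
  qed
  then show "d0 (W_pencil a) q = - (\<mu> q v* cof (J q + a *\<^sub>R P2))"
    unfolding A_coef_expansion vector_matrix_sum_scaleR
    by (simp add: d0_def vec_eq_iff sum_negf)
qed

lemma H_separately_differentiable:
  assumes q: "q \<in> U" and i: "i \<in> {1..CARD('n) + 1}"
  shows "separately_differentiable (H_fn g J i (W i)) (q, p)"
proof -
  have "entries_differentiable (\<lambda>z. A_coef i (J z)) q"
    by (simp add: entries_differentiable_def A_coef_differentiable q)
  moreover have "entries_differentiable (\<lambda>z. matrix_inv (g z)) q"
    by (rule entries_differentiable_matrix_inv[OF open_U q metric_det metric_differentiable[OF q]])
  ultimately show ?thesis
    unfolding H_fn_quadratic
    by (intro separately_differentiable_quadratic entries_differentiable_mult W_differentiable q i)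
qed

lemma finite_singular: "q \<in> U \<Longrightarrow> finite {a. det (J q + a *\<^sub>R P2) = 0}"
  using cofactor by (intro finite_singular_pencil) (simp add: cofactor_system_def invertible_det_nz)

lemma H_first_integral:
  assumes i: "i \<in> {1..CARD('n) + 1}"
  shows "first_integral U g \<mu> (H_fn g J i (W i))"
  unfolding first_integral_def
proof (intro ballI allI)
  fix q p assume q: "q \<in> U"
  have "(\<Sum>i = 1..CARD('n) + 1. a ^ (i - 1) * Gamma_hat g \<mu> (H_fn g J i (W i)) (q, p)) = 0"
    if "a \<notin> {a. det (J q + a *\<^sub>R P2) = 0}" for a
  proof -
    interpret Ja: scKt_domain U g "\<lambda>z. J z + a *\<^sub>R P2" by (rule scKt_pencil)
    \<comment> \<open>The vector field depends only on g and \<mu>, so all generating functions are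
      integrals of one and the same dynamics.\<close>
    have "Gamma_hat g \<mu> (H_pencil a) (q, p) = 0"
      using that by (intro Ja.Gamma_hat_cof q W_pencil) auto
    then show ?thesis
      by (simp only: quadratic_cof_pencil
          Gamma_hat_sum[where F = "\<lambda>i. H_fn g J i (W i)", OF q H_separately_differentiable[OF q]])
  qed
  then show "Gamma_hat g \<mu> (H_fn g J i (W i)) (q, p) = 0"
    by (rule eq_0_if_power_sum_eq_0[OF finite_singular[OF q] _ i])
qed

text \<open>The brackets belong to J and P2, whereas the derivatives of the two functions come from
  J + a P2 and J + b P2. They fit together because \<open>horizontal\<close> depends on g alone and
  all pencil tensors share dtr; for P2 itself the trace is constant and the extra term of the
  bracket disappears.\<close>

lemma H_pencil_involution:
  assumes q: "q \<in> U" and det: "det (J q + a *\<^sub>R P2) \<noteq> 0" "det (J q + b *\<^sub>R P2) \<noteq> 0" and ab: "a \<noteq> b"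
  shows "bracket J (H_pencil a) (H_pencil b) (q, p) = 0"
    and "bracket (\<lambda>_. P2) (H_pencil a) (H_pencil b) (q, p) = 0"
proof -
  interpret Ja: scKt_domain U g "\<lambda>z. J z + a *\<^sub>R P2" by (rule scKt_pencil)
  interpret Jb: scKt_domain U g "\<lambda>z. J z + b *\<^sub>R P2" by (rule scKt_pencil)
  interpret P2: scKt_domain U g "\<lambda>_. P2" by unfold_locales (rule scKt_P2)
  note Ha = Ja.horizontal_cof[of q "W_pencil a" \<mu> p, OF q det(1) W_pencil[OF q]]
  note Hb = Jb.horizontal_cof[of q "W_pencil b" \<mu> p, OF q det(2) W_pencil[OF q]]
  note involution = pencil_involution[OF ab det cof_right cof_left[OF det(1)] cof_right cof_left[OF det(2)]
      Ha(2)[unfolded d0_trace_pencil[OF q]] Hb(2)[unfolded d0_trace_pencil[OF q]]]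
  show "bracket J (H_pencil a) (H_pencil b) (q, p) = 0"
    unfolding bracket_horizontal[OF q] Ha(1) Hb(1) involution(2) by simp
  have "d0 (\<lambda>_. trace (P2 :: real ^ ('m + 'n) ^ ('m + 'n))) q = 0" by (simp add: d0_def vec_eq_iff)
  then show "bracket (\<lambda>_. P2) (H_pencil a) (H_pencil b) (q, p) = 0"
    unfolding P2.bracket_horizontal[OF q] Ha(1) Hb(1) involution(1) by simp
qed

text \<open>Bilinearity turns the bracket of two generating functions into a double power sum in
  \<open>a\<close> and \<open>b\<close>, whose coefficients are the brackets of the single
  functions.\<close>

lemma H_involution:
  assumes q: "q \<in> U" and i: "i \<in> {1..CARD('n) + 1}" and l: "l \<in> {1..CARD('n) + 1}"
  shows "bracket J (H_fn g J i (W i)) (H_fn g J l (W l)) (q, p) = 0"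
    and "bracket (\<lambda>_. P2) (H_fn g J i (W i)) (H_fn g J l (W l)) (q, p) = 0"
proof -
  interpret P2: scKt_domain U g "\<lambda>_. P2" by unfold_locales (rule scKt_P2)
  show "bracket J (H_fn g J i (W i)) (H_fn g J l (W l)) (q, p) = 0"
  proof (rule eq_0_if_double_power_sum_eq_0[OF finite_singular[OF q] _ i l,
        where c = "\<lambda>i l. bracket J (H_fn g J i (W i)) (H_fn g J l (W l)) (q, p)"])
    fix a b assume "a \<notin> {a. det (J q + a *\<^sub>R P2) = 0}" "b \<notin> {a. det (J q + a *\<^sub>R P2) = 0}" "a \<noteq> b"
    then have "bracket J (H_pencil a) (H_pencil b) (q, p) = 0"
      by (intro H_pencil_involution q) auto
    then show "(\<Sum>i = 1..CARD('n) + 1. a ^ (i - 1) * (\<Sum>l = 1..CARD('n) + 1. b ^ (l - 1) *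
        bracket J (H_fn g J i (W i)) (H_fn g J l (W l)) (q, p))) = 0"
      by (simp only: quadratic_cof_pencil
          bracket_sum_left[where F = "\<lambda>i. H_fn g J i (W i)", OF q H_separately_differentiable[OF q]]
          bracket_sum_right[where F = "\<lambda>i. H_fn g J i (W i)", OF q H_separately_differentiable[OF q]])
  qed
  show "bracket (\<lambda>_. P2) (H_fn g J i (W i)) (H_fn g J l (W l)) (q, p) = 0"
  proof (rule eq_0_if_double_power_sum_eq_0[OF finite_singular[OF q] _ i l,
        where c = "\<lambda>i l. bracket (\<lambda>_. P2) (H_fn g J i (W i)) (H_fn g J l (W l)) (q, p)"])
    fix a b assume "a \<notin> {a. det (J q + a *\<^sub>R P2) = 0}" "b \<notin> {a. det (J q + a *\<^sub>R P2) = 0}" "a \<noteq> b"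
    then have "bracket (\<lambda>_. P2) (H_pencil a) (H_pencil b) (q, p) = 0"
      by (intro H_pencil_involution q) auto
    then show "(\<Sum>i = 1..CARD('n) + 1. a ^ (i - 1) * (\<Sum>l = 1..CARD('n) + 1. b ^ (l - 1) *
        bracket (\<lambda>_. P2) (H_fn g J i (W i)) (H_fn g J l (W l)) (q, p))) = 0"
      by (simp only: quadratic_cof_pencil
          P2.bracket_sum_left[where F = "\<lambda>i. H_fn g J i (W i)", OF q H_separately_differentiable[OF q]]
          P2.bracket_sum_right[where F = "\<lambda>i. H_fn g J i (W i)", OF q H_separately_differentiable[OF q]])
  qed
qed

end

end

theorem mainTheorem6:
  fixes U :: "(real ^ ('m::finite + 'n::finite)) set"
    and g J :: "real ^ ('m + 'n) \<Rightarrow> real ^ ('m + 'n) ^ ('m + 'n)"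
    and \<mu> :: "real ^ ('m + 'n) \<Rightarrow> real ^ ('m + 'n)"
  assumes "coordinate_domain U"
    and "driven_cofactor_system U g \<mu> J"
    and "\<forall>q\<in>U. invertible (J q)"
    and "\<forall>q\<in>U. invertible (J1_block (J q))"
  shows "(\<forall>i\<in>{1..CARD('n) + 1}. \<exists>W. is_potential U (\<lambda>q. \<mu> q v* A_coef i (J q)) W) \<and>
    (\<forall>W :: nat \<Rightarrow> real ^ ('m + 'n) \<Rightarrow> real.
       (\<forall>i\<in>{1..CARD('n) + 1}. is_potential U (\<lambda>q. \<mu> q v* A_coef i (J q)) (W i)) \<longrightarrow>
       (\<forall>i\<in>{1..CARD('n) + 1}. first_integral U g \<mu> (H_fn g J i (W i))) \<and>
       (\<forall>i\<in>{1..CARD('n) + 1}. \<forall>l\<in>{1..CARD('n) + 1}. \<forall>q\<in>U. \<forall>p.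
          bracket J (H_fn g J i (W i)) (H_fn g J l (W l)) (q, p) = 0 \<and>
          bracket (\<lambda>_. P2) (H_fn g J i (W i)) (H_fn g J l (W l)) (q, p) = 0))"
proof -
  interpret driven_domain U g J \<mu> by unfold_locales (rule assms)+
  show ?thesis
  proof (rule conjI; intro ballI allI impI)
    show "\<exists>W. is_potential U (\<lambda>q. \<mu> q v* A_coef i (J q)) W" if "i \<in> {1..CARD('n) + 1}" for i
      by (rule A_coef_potential_exists[OF that])
  next
    fix W :: "nat \<Rightarrow> real ^ ('m + 'n) \<Rightarrow> real"
    assume "\<forall>i\<in>{1..CARD('n) + 1}. is_potential U (\<lambda>q. \<mu> q v* A_coef i (J q)) (W i)"
    then have W: "\<And>i. i \<in> {1..CARD('n) + 1} \<Longrightarrow> is_potential U (\<lambda>q. \<mu> q v* A_coef i (J q)) (W i)" by blast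
    show "(\<forall>i\<in>{1..CARD('n) + 1}. first_integral U g \<mu> (H_fn g J i (W i))) \<and>
       (\<forall>i\<in>{1..CARD('n) + 1}. \<forall>l\<in>{1..CARD('n) + 1}. \<forall>q\<in>U. \<forall>p.
          bracket J (H_fn g J i (W i)) (H_fn g J l (W l)) (q, p) = 0 \<and>
          bracket (\<lambda>_. P2) (H_fn g J i (W i)) (H_fn g J l (W l)) (q, p) = 0)"
      by (intro conjI ballI allI H_first_integral H_involution W)
  qed
qed

end
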